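(* Let $d,r\ge 1$ be integers, and let $M\subseteq H^2\otimes\mathbb C^r$ be a closed invariant subspace for the $d$-shift $(S_1,\dots,S_d)$ of rank $r$ that is generated, as a closed invariant subspace, by some (arbitrary) set of monomials. Let $P_M$ be the orthogonal projection of $H^2\otimes\mathbb C^r$ onto $M$. Then for every $p>2d$, $$P_MS_k-S_kP_M\in\mathcal L^p,\qquad 1\le k\le d.$$
   Context: $H^2=H^2(\mathbb C^d)$ is the symmetric Fock space over $\mathbb C^d$, realized as a Hilbert space of holomorphic functions on the open unit ball of $\mathbb C^d$ in which the monomials $z^n=z_1^{n_1}\cdots z_d^{n_d}$, $n=(n_1,\dots,n_d)\in\mathbb Z^d$, $n\ge0$ (meaning every $n_k\ge 0$), form an orthogonal set with dense span, with $\|z^n\|^2=\frac{n_1!\cdots n_d!}{(n_1+\cdots+n_d)!}$. The $d$-shift of rank $r$ is the $d$-tuple of commuting bounded operators $S_1,\dots,S_d$ on $H^2\otimes\mathbb C^r$ determined by $S_k(f\otimes\zeta)=z_kf\otimes\zeta$ for $f\in H^2$, $\zeta\in\mathbb C^r$. A monomial in $H^2\otimes\mathbb C^r$ is an element of the form $z^n\otimes\zeta$ with $n\ge0$, $\zeta\in\mathbb C^r$. A closed subspace is invariant if it is mapped into itself by each of $S_1,\dots,S_d$; the closed invariant subspace generated by a set is the smallest one containing it. $\mathcal L^p$ denotes the Schatten–von Neumann class of all compact operators whose singular value list is $p$-summable. *)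

theory Defs
  imports "HOL-Analysis.Analysis"
begin

section \<open>Operators on complex Hilbert spaces\<close>

text \<open>The inner product is linear in its first argument.  The superclass \<^class>\<open>real_inner\<close>
  supplies the norm and the topology through the real part of the complex inner product.\<close>
class complex_hilbert = real_inner + complete_space +
  fixes scaleC :: "complex \<Rightarrow> 'a \<Rightarrow> 'a" (infixr "*\<^sub>C" 75)
    and cinner :: "'a \<Rightarrow> 'a \<Rightarrow> complex"
  assumes scaleC_add_right: "c *\<^sub>C (x + y) = c *\<^sub>C x + c *\<^sub>C y"
    and scaleC_add_left: "(b + c) *\<^sub>C x = b *\<^sub>C x + c *\<^sub>C x"
    and scaleC_scaleC: "b *\<^sub>C c *\<^sub>C x = (b * c) *\<^sub>C x"
    and scaleR_scaleC: "r *\<^sub>R x = complex_of_real r *\<^sub>C x"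
    and cinner_commute: "cinner x y = cnj (cinner y x)"
    and cinner_add_left: "cinner (x + y) z = cinner x z + cinner y z"
    and cinner_scaleC_left: "cinner (c *\<^sub>C x) y = c * cinner x y"
    and inner_eq_Re_cinner: "inner x y = Re (cinner x y)"

lemma scaleC_one: "1 *\<^sub>C x = (x :: 'a::complex_hilbert)"
  using scaleR_scaleC[of 1 x] by simp

global_interpretation complex_vector: vector_space "scaleC :: complex \<Rightarrow> 'a \<Rightarrow> 'a::complex_hilbert"
  by unfold_locales (simp_all add: scaleC_add_right scaleC_add_left scaleC_scaleC scaleC_one)

lemma cinner_self: "cinner x x = complex_of_real ((norm x)\<^sup>2)" for x :: "'a::complex_hilbert"
proof (rule complex_eqI)
  show "Im (cinner x x) = Im (complex_of_real ((norm x)\<^sup>2))"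
    using arg_cong[OF cinner_commute[of x x], of Im] by simp
qed (simp add: inner_eq_Re_cinner[symmetric] dot_square_norm)

instantiation vec :: (complex_hilbert, finite) complex_hilbert
begin

definition scaleC_vec :: "complex \<Rightarrow> 'a ^ 'b \<Rightarrow> 'a ^ 'b" where
  "scaleC_vec c x = (\<chi> i. c *\<^sub>C x $ i)"

definition cinner_vec :: "'a ^ 'b \<Rightarrow> 'a ^ 'b \<Rightarrow> complex" where
  "cinner_vec x y = (\<Sum>i\<in>UNIV. cinner (x $ i) (y $ i))"

instance
proof
  fix x y z :: "'a ^ 'b" and b c :: complex and r :: real
  show "c *\<^sub>C (x + y) = c *\<^sub>C x + c *\<^sub>C y"
    by (simp add: vec_eq_iff scaleC_vec_def scaleC_add_right)
  show "(b + c) *\<^sub>C x = b *\<^sub>C x + c *\<^sub>C x"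
    by (simp add: vec_eq_iff scaleC_vec_def scaleC_add_left)
  show "b *\<^sub>C c *\<^sub>C x = (b * c) *\<^sub>C x"
    by (simp add: vec_eq_iff scaleC_vec_def scaleC_scaleC)
  show "r *\<^sub>R x = complex_of_real r *\<^sub>C x"
    by (simp add: vec_eq_iff scaleC_vec_def scaleR_scaleC)
  show "cinner x y = cnj (cinner y x)"
    unfolding cinner_vec_def cnj_sum by (intro sum.cong refl cinner_commute)
  show "cinner (x + y) z = cinner x z + cinner y z"
    by (simp add: cinner_vec_def cinner_add_left sum.distrib)
  show "cinner (c *\<^sub>C x) y = c * cinner x y"
    by (simp add: cinner_vec_def scaleC_vec_def cinner_scaleC_left sum_distrib_left)
  show "inner x y = Re (cinner x y)"
    by (simp add: cinner_vec_def inner_vec_def inner_eq_Re_cinner)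
qed

end

text \<open>The two descriptions below have a unique solution if \<open>T\<close> is bounded and complex linear, and if
  \<open>M\<close> is a closed complex subspace, respectively.\<close>
definition hilbert_adjoint :: "('a::complex_hilbert \<Rightarrow> 'a) \<Rightarrow> 'a \<Rightarrow> 'a" where
  "hilbert_adjoint T = (THE T'. \<forall>x y. cinner (T x) y = cinner x (T' y))"

definition orth_proj :: "'a::complex_hilbert set \<Rightarrow> 'a \<Rightarrow> 'a" where
  "orth_proj M x = (THE y. y \<in> M \<and> (\<forall>u\<in>M. cinner (x - y) u = 0))"

definition compact_operator :: "('a::complex_hilbert \<Rightarrow> 'a) \<Rightarrow> bool" where
  "compact_operator T \<longleftrightarrow>
     Vector_Spaces.linear scaleC scaleC T \<and> compact (closure (T ` cball 0 1))"

text \<open>The singular values are the square roots of the eigenvalues of \<open>T\<^sup>* T\<close>, listed in decreasing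
  order and repeated according to multiplicity; the list is filled up with zeros if \<open>T\<close> has finite
  rank.  The eigenvalue \<open>0\<close> is not counted, so an operator of infinite rank with a kernel has a
  list without zeros.  If \<open>T\<close> is compact, the eigenspaces in question have finite dimension and there is
  exactly one such list.  (The dimension function of the library is \<open>0\<close> on infinite-dimensional
  spaces, so this predicate is only meant for compact operators.)\<close>
definition singular_value_list :: "('a::complex_hilbert \<Rightarrow> 'a) \<Rightarrow> (nat \<Rightarrow> real) \<Rightarrow> bool" where
  "singular_value_list T s \<longleftrightarrow>
     decseq s \<and> (\<forall>n. 0 \<le> s n) \<and>
     (\<forall>t>0. finite {n. s n = t} \<and>
        card {n. s n = t} =
          complex_vector.dim {x. hilbert_adjoint T (T x) = complex_of_real (t\<^sup>2) *\<^sub>C x})"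

definition schatten_class :: "real \<Rightarrow> ('a::complex_hilbert \<Rightarrow> 'a) set" where
  "schatten_class p =
     {T. compact_operator T \<and> (\<exists>s. singular_value_list T s \<and> summable (\<lambda>n. s n powr p))}"

section \<open>Power series on the unit ball\<close>

definition mi_deg :: "('d::finite \<Rightarrow> nat) \<Rightarrow> nat" where
  "mi_deg n = (\<Sum>i\<in>UNIV. n i)"

text \<open>The squared norm of the monomial \<open>z\<^sup>n\<close> in \<open>H\<^sup>2\<close>.\<close>
definition fock_weight :: "('d::finite \<Rightarrow> nat) \<Rightarrow> real" where
  "fock_weight n = (\<Prod>i\<in>UNIV. fact (n i)) / fact (mi_deg n)"

definition zpow :: "complex ^ 'd \<Rightarrow> ('d::finite \<Rightarrow> nat) \<Rightarrow> complex" where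
  "zpow z n = (\<Prod>i\<in>UNIV. (z $ i) ^ n i)"

lemma mi_deg_upd: "mi_deg (n(j := Suc (n j))) = Suc (mi_deg n)"
proof -
  have "mi_deg (n(j := Suc (n j))) = (\<Sum>i\<in>UNIV. n i + (if i = j then 1 else 0))"
    unfolding mi_deg_def by (intro sum.cong) auto
  also have "\<dots> = Suc (mi_deg n)" by (simp add: sum.distrib mi_deg_def)
  finally show ?thesis .
qed

lemma prod_upd_Suc:
  fixes h :: "'d::finite \<Rightarrow> nat \<Rightarrow> 'a::comm_monoid_mult"
  assumes "h j (Suc (n j)) = h j (n j) * c"
  shows "(\<Prod>i\<in>UNIV. h i ((n(j := Suc (n j))) i)) = (\<Prod>i\<in>UNIV. h i (n i)) * c"
proof -
  have "(\<Prod>i\<in>UNIV. h i ((n(j := Suc (n j))) i)) = (\<Prod>i\<in>UNIV. h i (n i) * (if i = j then c else 1))"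
    by (intro prod.cong) (auto simp: assms)
  also have "\<dots> = (\<Prod>i\<in>UNIV. h i (n i)) * c" by (simp add: prod.distrib)
  finally show ?thesis .
qed

lemma zpow_upd: "zpow z (n(j := Suc (n j))) = z $ j * zpow z n"
  unfolding zpow_def by (subst prod_upd_Suc[where h = "\<lambda>i k. (z $ i) ^ k" and c = "z $ j"]) auto

lemma fock_weight_pos [simp]: "fock_weight n > 0"
  unfolding fock_weight_def by (intro divide_pos_pos prod_pos) auto

lemma fock_weight_nonneg [simp]: "fock_weight n \<ge> 0"
  using fock_weight_pos less_imp_le by blast

lemma fock_weight_nz [simp]: "fock_weight n \<noteq> 0"
  using fock_weight_pos[of n] by linarith

lemma fock_weight_upd:
  "fock_weight (n(j := Suc (n j))) = fock_weight n * (real (Suc (n j)) / real (Suc (mi_deg n)))"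
proof -
  have "(\<Prod>i\<in>UNIV. fact ((n(j := Suc (n j))) i) :: real) = (\<Prod>i\<in>UNIV. fact (n i)) * real (Suc (n j))"
    by (rule prod_upd_Suc[where h = "\<lambda>i k. fact k"]) auto
  thus ?thesis by (simp add: fock_weight_def mi_deg_upd)
qed

lemma finite_mi_deg: "finite {n :: 'd::finite \<Rightarrow> nat. mi_deg n \<le> k}"
proof (rule finite_subset)
  show "{n :: 'd \<Rightarrow> nat. mi_deg n \<le> k} \<subseteq> PiE UNIV (\<lambda>_. {..k})"
  proof safe
    fix n :: "'d \<Rightarrow> nat" and i assume "mi_deg n \<le> k"
    moreover have "n i \<le> mi_deg n" unfolding mi_deg_def by (intro member_le_sum) auto
    ultimately show "n i \<le> k" by simp
  qed auto
qed (auto intro: finite_PiE)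

lemma finite_mi_deg_eq: "finite {n :: 'd::finite \<Rightarrow> nat. mi_deg n = k}"
  by (rule finite_subset[OF _ finite_mi_deg[of k]]) auto

lemma multinomial_sum:
  fixes x :: "'d::finite \<Rightarrow> real"
  shows "(\<Sum>n | mi_deg n = k. (\<Prod>i\<in>UNIV. x i ^ n i) / fock_weight n) = (\<Sum>i\<in>UNIV. x i) ^ k"
proof (induction k)
  case 0
  have "{n :: 'd \<Rightarrow> nat. mi_deg n = 0} = {\<lambda>_. 0}" by (auto simp: mi_deg_def)
  thus ?case by (simp add: fock_weight_def mi_deg_def)
next
  case (Suc k)
  define g where "g n = (\<Prod>i\<in>UNIV. x i ^ n i) / fock_weight n" for n
  have g_upd: "g (n(j := Suc (n j))) * (real (Suc (n j)) / real (Suc (mi_deg n))) = g n * x j" for n j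
  proof -
    have "(\<Prod>i\<in>UNIV. x i ^ (n(j := Suc (n j))) i) = (\<Prod>i\<in>UNIV. x i ^ n i) * x j"
      by (rule prod_upd_Suc[where h = "\<lambda>i k. x i ^ k"]) auto
    thus ?thesis unfolding g_def fock_weight_upd by (simp del: of_nat_Suc fun_upd_apply)
  qed
  have split: "g n = (\<Sum>j\<in>UNIV. g n * (real (n j) / real (Suc k)))" if "mi_deg n = Suc k" for n
  proof -
    have "(\<Sum>j\<in>UNIV. g n * (real (n j) / real (Suc k))) = g n * (real (\<Sum>j\<in>UNIV. n j) / real (Suc k))"
      by (simp add: sum_distrib_left sum_divide_distrib)
    also have "(\<Sum>j\<in>UNIV. n j) = Suc k" using that by (simp add: mi_deg_def)
    finally show ?thesis by simp
  qed
  have "(\<Sum>n | mi_deg n = Suc k. g n) = (\<Sum>n | mi_deg n = Suc k. \<Sum>j\<in>UNIV. g n * (real (n j) / real (Suc k)))"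
    by (intro sum.cong refl split) auto
  also have "\<dots> = (\<Sum>j\<in>UNIV. \<Sum>n | mi_deg n = Suc k. g n * (real (n j) / real (Suc k)))"
    by (rule sum.swap)
  also have "\<dots> = (\<Sum>j\<in>UNIV. \<Sum>n | mi_deg n = k. g n * x j)"
  proof (rule sum.cong[OF refl])
    fix j
    have "(\<Sum>n | mi_deg n = Suc k. g n * (real (n j) / real (Suc k))) =
          (\<Sum>n | mi_deg n = Suc k \<and> n j > 0. g n * (real (n j) / real (Suc k)))"
      by (rule sum.mono_neutral_right) (auto simp: finite_mi_deg_eq)
    also have "\<dots> = (\<Sum>n | mi_deg n = k. g n * x j)"
    proof (rule sum.reindex_bij_witness[of _ "\<lambda>n. n(j := Suc (n j))" "\<lambda>n. n(j := n j - 1)"])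
      fix n :: "'d \<Rightarrow> nat" assume n: "n \<in> {n. mi_deg n = Suc k \<and> n j > 0}"
      define m where "m = n(j := n j - 1)"
      have nm: "n = m(j := Suc (m j))" using n by (auto simp: m_def)
      show "(n(j := n j - 1))(j := Suc ((n(j := n j - 1)) j)) = n" using nm m_def by simp
      have dm: "mi_deg m = k" using n mi_deg_upd[of m j] by (simp flip: nm)
      thus "n(j := n j - 1) \<in> {n. mi_deg n = k}" by (simp add: m_def)
      have nj: "n j = Suc (m j)" using n by (simp add: m_def)
      have "g m * x j = g n * (real (n j) / real (Suc k))"
        using g_upd[of m j] unfolding nm[symmetric] nj dm by simp
      thus "g (n(j := n j - 1)) * x j = g n * (real (n j) / real (Suc k))"
        by (simp only: m_def)
    qed (auto simp: mi_deg_upd)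
    finally show "(\<Sum>n | mi_deg n = Suc k. g n * (real (n j) / real (Suc k))) = (\<Sum>n | mi_deg n = k. g n * x j)" .
  qed
  also have "\<dots> = (\<Sum>j\<in>UNIV. (\<Sum>n | mi_deg n = k. g n) * x j)"
    by (simp only: sum_distrib_right)
  also have "(\<Sum>n | mi_deg n = k. g n) = (\<Sum>i\<in>UNIV. x i) ^ k"
    unfolding g_def by (rule Suc.IH)
  also have "(\<Sum>j\<in>UNIV. (\<Sum>i\<in>UNIV. x i) ^ k * x j) = (\<Sum>i\<in>UNIV. x i) ^ Suc k"
    by (simp only: sum_distrib_left[symmetric] power_Suc2)
  finally show ?case by (simp add: g_def)
qed

lemma zpow_weight_summable:
  fixes z :: "complex ^ 'd::finite"
  assumes "z \<in> ball 0 1"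
  shows "(\<lambda>n. (cmod (zpow z n))\<^sup>2 / fock_weight n) summable_on UNIV"
proof -
  define x where "x i = (cmod (z $ i))\<^sup>2" for i
  define s where "s = (\<Sum>i\<in>UNIV. x i)"
  define g where "g n = (cmod (zpow z n))\<^sup>2 / fock_weight n" for n
  have s: "s \<ge> 0" "s < 1"
  proof -
    show "s \<ge> 0" by (auto simp: s_def x_def intro: sum_nonneg)
    have "norm z < 1" using assms by simp
    hence "sqrt s < 1" by (simp add: norm_vec_def L2_set_def s_def x_def)
    thus "s < 1" by simp
  qed
  have g: "g n = (\<Prod>i\<in>UNIV. x i ^ n i) / fock_weight n" for n
    unfolding g_def zpow_def x_def
    by (simp add: prod_norm[symmetric] norm_power prod_power_distrib power_mult[symmetric] mult.commute)
  have gk: "(\<Sum>n | mi_deg n = k. g n) = s ^ k" for k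
    unfolding g s_def by (rule multinomial_sum)
  show ?thesis unfolding g_def[symmetric]
  proof (rule nonneg_bdd_above_summable_on)
    show "g n \<ge> 0" for n by (simp add: g_def)
    show "bdd_above (sum g ` {F. F \<subseteq> UNIV \<and> finite F})"
    proof (rule bdd_aboveI2)
      fix F :: "('d \<Rightarrow> nat) set" assume "F \<in> {F. F \<subseteq> UNIV \<and> finite F}"
      hence F: "finite F" by simp
      define K where "K = Max (insert 0 (mi_deg ` F))"
      have "mi_deg n \<le> K" if "n \<in> F" for n unfolding K_def using F that by (intro Max_ge) auto
      hence sub: "F \<subseteq> (\<Union>k\<in>{..K}. {n. mi_deg n = k})" by auto
      have "sum g F \<le> sum g (\<Union>k\<in>{..K}. {n. mi_deg n = k})"
        by (rule sum_mono2[OF _ sub]) (auto simp: finite_mi_deg_eq g_def)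
      also have "\<dots> = (\<Sum>k\<le>K. s ^ k)"
        by (subst sum.UNION_disjoint) (auto simp: finite_mi_deg_eq gk)
      also have "\<dots> \<le> (\<Sum>k. s ^ k)"
        using s by (intro sum_le_suminf) (auto intro: summable_geometric)
      finally show "sum g F \<le> (\<Sum>k. s ^ k)" .
    qed
  qed
qed

lemma fock_series_abs_summable:
  fixes z :: "complex ^ 'd::finite"
  assumes "(\<lambda>n. (cmod (a n))\<^sup>2 * fock_weight n) summable_on UNIV" "z \<in> ball 0 1"
  shows "(\<lambda>n. norm (a n * zpow z n)) summable_on UNIV"
proof (rule summable_on_comparison_test)
  show "(\<lambda>n. (cmod (a n))\<^sup>2 * fock_weight n + (cmod (zpow z n))\<^sup>2 / fock_weight n) summable_on UNIV"
    using assms by (intro summable_on_add zpow_weight_summable) auto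
  fix n :: "'d \<Rightarrow> nat"
  define w where "w = sqrt (fock_weight n)"
  have w: "w > 0" "fock_weight n = w\<^sup>2" by (auto simp: w_def)
  define u v where "u = cmod (a n)" and "v = cmod (zpow z n)"
  have uv: "u \<ge> 0" "v \<ge> 0" by (auto simp: u_def v_def)
  have "u * v = (u * w) * (v / w)" using w by simp
  also have "\<dots> \<le> (u * w)\<^sup>2 + (v / w)\<^sup>2"
  proof -
    have *: "p * q \<le> p\<^sup>2 + q\<^sup>2" if "0 \<le> p * q" for p q :: real
      using sum_squares_bound[of p q] that by linarith
    show ?thesis by (rule *) (use uv w(1) in simp)
  qed
  finally show "norm (a n * zpow z n) \<le> (cmod (a n))\<^sup>2 * fock_weight n + (cmod (zpow z n))\<^sup>2 / fock_weight n"
    by (simp add: norm_mult w(2) u_def v_def power_mult_distrib power_divide)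
qed auto

lemma digits_unique:
  fixes u v :: "nat \<Rightarrow> nat"
  assumes "\<And>j. j < D \<Longrightarrow> u j < N" "\<And>j. j < D \<Longrightarrow> v j < N"
    and "(\<Sum>j<D. N ^ j * u j) = (\<Sum>j<D. N ^ j * v j)" "j < D"
  shows "u j = v j"
  using assms
proof (induction D arbitrary: u v j)
  case 0
  then show ?case by simp
next
  case (Suc D)
  have *: "(\<Sum>j<Suc D. N ^ j * w j) = w 0 + N * (\<Sum>j<D. N ^ j * w (Suc j))" for w :: "nat \<Rightarrow> nat"
    unfolding sum.lessThan_Suc_shift by (simp add: sum_distrib_left mult.assoc)
  have N: "u 0 < N" "v 0 < N" using Suc.prems by auto
  have eq: "u 0 + N * (\<Sum>j<D. N ^ j * u (Suc j)) = v 0 + N * (\<Sum>j<D. N ^ j * v (Suc j))"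
    using Suc.prems(3) unfolding * .
  have 0: "u 0 = v 0" using arg_cong[OF eq, of "\<lambda>x. x mod N"] N by simp
  hence "N * (\<Sum>j<D. N ^ j * u (Suc j)) = N * (\<Sum>j<D. N ^ j * v (Suc j))" using eq by simp
  hence "(\<Sum>j<D. N ^ j * u (Suc j)) = (\<Sum>j<D. N ^ j * v (Suc j))" using N by simp
  hence "u (Suc i) = v (Suc i)" if "i < D" for i
    using Suc.IH[of "\<lambda>j. u (Suc j)" "\<lambda>j. v (Suc j)" i] Suc.prems that by auto
  thus ?case using 0 Suc.prems(4) by (cases j) auto
qed

lemma weight_functional:
  fixes k :: nat
  obtains l :: "'d::finite \<Rightarrow> nat" and m where
    "inj_on (\<lambda>n. \<Sum>i\<in>UNIV. l i * n i) {n. mi_deg n = k}"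
    "\<And>n. mi_deg n = k \<Longrightarrow> (\<Sum>i\<in>UNIV. l i * n i) < m"
    "\<And>n. mi_deg n > k \<Longrightarrow> (\<Sum>i\<in>UNIV. l i * n i) \<ge> m"
proof -
  obtain h where h: "bij_betw h {..<CARD('d)} (UNIV :: 'd set)"
    using ex_bij_betw_nat_finite[of "UNIV :: 'd set"] by (auto simp: atLeast0LessThan)
  define e where "e = the_inv_into {..<CARD('d)} h"
  have eh: "e (h j) = j" if "j < CARD('d)" for j
    using h that by (auto simp: e_def bij_betw_def the_inv_into_f_f)
  define N where "N = Suc k"
  define b where "b n = (\<Sum>i\<in>UNIV. N ^ e i * n i)" for n
  define B where "B = Suc (Max (b ` {n. mi_deg n = k}))"
  have bB: "b n < B" if "mi_deg n = k" for n
    unfolding B_def using that by (auto intro!: le_imp_less_Suc Max_ge simp: finite_mi_deg_eq)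
  define l where "l i = B + N ^ e i" for i
  have l: "(\<Sum>i\<in>UNIV. l i * n i) = B * mi_deg n + b n" for n
    by (simp add: l_def b_def mi_deg_def sum.distrib sum_distrib_left algebra_simps)
  have bh: "b n = (\<Sum>j<CARD('d). N ^ j * n (h j))" for n
    unfolding b_def by (subst sum.reindex_bij_betw[OF h, symmetric]) (auto simp: eh intro!: sum.cong)
  show ?thesis
  proof (rule that[of l "B * k + B"])
    show "inj_on (\<lambda>n. \<Sum>i\<in>UNIV. l i * n i) {n. mi_deg n = k}"
    proof (rule inj_onI)
      fix n m assume nm: "n \<in> {n. mi_deg n = k}" "m \<in> {n. mi_deg n = k}"
        and "(\<Sum>i\<in>UNIV. l i * n i) = (\<Sum>i\<in>UNIV. l i * m i)"
      hence beq: "b n = b m" by (simp add: l)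
      have small: "n i < N" if "mi_deg n = k" for n :: "'d \<Rightarrow> nat" and i
      proof -
        have "n i \<le> mi_deg n" unfolding mi_deg_def by (intro member_le_sum) auto
        thus ?thesis using that by (simp add: N_def)
      qed
      have "n (h j) = m (h j)" if "j < CARD('d)" for j
        using digits_unique[of "CARD('d)" "\<lambda>j. n (h j)" N "\<lambda>j. m (h j)" j] beq nm small that
        by (auto simp: bh)
      hence "n i = m i" if "i \<in> h ` {..<CARD('d)}" for i using that by auto
      thus "n = m" using bij_betw_imp_surj_on[OF h] by auto
    qed
    show "(\<Sum>i\<in>UNIV. l i * n i) < B * k + B" if "mi_deg n = k" for n
      using bB[OF that] that by (simp add: l)
    show "(\<Sum>i\<in>UNIV. l i * n i) \<ge> B * k + B" if "mi_deg n > k" for n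
    proof -
      have "B * Suc k \<le> B * mi_deg n" using that by (intro mult_le_mono) auto
      thus ?thesis by (simp add: l)
    qed
  qed
qed

lemma fock_series_zero:
  fixes a :: "('d::finite \<Rightarrow> nat) \<Rightarrow> complex"
  assumes hs: "\<And>z. z \<in> ball 0 1 \<Longrightarrow> ((\<lambda>n. a n * zpow z n) has_sum 0) UNIV"
  shows "a n = 0"
proof (rule ccontr)
  assume "a n \<noteq> 0"
  define Q where "Q k \<longleftrightarrow> (\<exists>n. mi_deg n = k \<and> a n \<noteq> 0)" for k
  define k where "k = (LEAST k. Q k)"
  have "Q (mi_deg n)" using \<open>a n \<noteq> 0\<close> by (auto simp: Q_def)
  hence ex: "Q k" unfolding k_def by (rule LeastI)
  have low: "mi_deg n \<ge> k" if "a n \<noteq> 0" for n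
    unfolding k_def by (rule Least_le) (use that in \<open>auto simp: Q_def\<close>)
  obtain l :: "'d \<Rightarrow> nat" and m where
    inj: "inj_on (\<lambda>n. \<Sum>i\<in>UNIV. l i * n i) {n. mi_deg n = k}" and
    lt: "\<And>n. mi_deg n = k \<Longrightarrow> (\<Sum>i\<in>UNIV. l i * n i) < m" and
    ge: "\<And>n. mi_deg n > k \<Longrightarrow> (\<Sum>i\<in>UNIV. l i * n i) \<ge> m"
    by (rule weight_functional[of k]) blast
  define L where "L n = (\<Sum>i\<in>UNIV. l i * n i)" for n
  define n0 where "n0 = arg_min L (\<lambda>n. mi_deg n = k \<and> a n \<noteq> 0)"
  obtain n1 where n1: "mi_deg n1 = k \<and> a n1 \<noteq> 0" using ex by (auto simp: Q_def)
  have n0: "mi_deg n0 = k" "a n0 \<noteq> 0"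
    using arg_min_natI[of "\<lambda>n. mi_deg n = k \<and> a n \<noteq> 0", OF n1] by (auto simp: n0_def)
  have n0_min: "L n0 \<le> L n" if "mi_deg n = k" "a n \<noteq> 0" for n
    using arg_min_nat_le[of "\<lambda>n. mi_deg n = k \<and> a n \<noteq> 0" n L] that by (simp add: n0_def)
  have L_gt: "L n \<ge> Suc (L n0)" if "a n \<noteq> 0" "n \<noteq> n0" for n
  proof (cases "mi_deg n = k")
    case True
    hence "L n \<noteq> L n0" using inj that n0 by (auto simp: inj_on_def L_def)
    thus ?thesis using n0_min[OF True that(1)] by simp
  next
    case False
    hence "mi_deg n > k" using low[OF that(1)] by simp
    thus ?thesis using ge[of n] lt[OF n0(1)] by (simp add: L_def)
  qed
  define c :: real where "c = 1 / (2 * CARD('d))"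
  have c: "c > 0" by (simp add: c_def)
  define zz where "zz t = ((\<chi> i. complex_of_real (c * t ^ l i)) :: complex ^ 'd)" for t
  have zz_ball: "zz t \<in> ball 0 1" if "0 < t" "t \<le> 1" for t
  proof -
    have "norm (zz t) \<le> (\<Sum>i\<in>UNIV. norm (zz t $ i))"
      by (simp add: norm_vec_def L2_set_le_sum)
    also have "\<dots> \<le> (\<Sum>i\<in>(UNIV::'d set). c)"
      using that c by (intro sum_mono) (auto simp: zz_def norm_mult norm_power power_le_one mult_left_le)
    also have "\<dots> < 1" by (simp add: c_def)
    finally show ?thesis by simp
  qed
  have zpow_zz: "zpow (zz t) n = of_real (c ^ mi_deg n * t ^ L n)" for t n
    by (simp add: zpow_def zz_def L_def mi_deg_def power_mult_distrib prod.distrib power_sum power_mult)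
  define A where "A n = norm (a n) * c ^ mi_deg n" for n
  have "(\<lambda>n. norm (a n * zpow (zz 1) n)) summable_on UNIV"
    by (rule summable_on_iff_abs_summable_on_complex[THEN iffD1])
      (rule has_sum_imp_summable[OF hs[OF zz_ball]], auto)
  also have "(\<lambda>n. norm (a n * zpow (zz 1) n)) = A"
    using c by (auto simp: zpow_zz A_def norm_mult norm_power)
  finally have A_sum: "A summable_on UNIV" .
  have bound: "A n0 \<le> t * infsum A UNIV" if t: "0 < t" "t \<le> 1" for t
  proof -
    define q where "q n = a n * zpow (zz t) n" for n
    have q: "(q has_sum 0) UNIV" unfolding q_def by (rule hs[OF zz_ball[OF t]])
    have "((\<lambda>n. if n = n0 then q n0 else 0) has_sum q n0) UNIV"
      by (rule has_sum_finite_neutralI[of "{n0}"]) auto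
    from has_sum_add[OF q has_sum_uminusI[OF this]]
    have "((\<lambda>n. q n + - (if n = n0 then q n0 else 0)) has_sum - q n0) UNIV" by simp
    moreover have "(\<lambda>n. q n + - (if n = n0 then q n0 else 0)) = (\<lambda>n. if n = n0 then 0 else q n)"
      by auto
    ultimately have d: "((\<lambda>n. if n = n0 then 0 else q n) has_sum - q n0) UNIV" by simp
    have le: "norm (if n = n0 then 0 else q n) \<le> t ^ Suc (L n0) * A n" for n
    proof (cases "n = n0 \<or> a n = 0")
      case False
      have "t ^ L n \<le> t ^ Suc (L n0)"
        using t L_gt[of n] False by (intro power_decreasing) auto
      hence "A n * t ^ L n \<le> A n * t ^ Suc (L n0)"
        using c by (intro mult_left_mono) (auto simp: A_def)
      thus ?thesis using False c t
        by (simp add: q_def zpow_zz norm_mult norm_power A_def mult_ac)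
    qed (use c t in \<open>auto simp: q_def A_def\<close>)
    have "norm (- q n0) \<le> t ^ Suc (L n0) * infsum A UNIV"
      by (rule norm_infsum_le[OF d has_sum_cmult_right[OF has_sum_infsum[OF A_sum]] le])
    hence "t ^ L n0 * A n0 \<le> t ^ L n0 * (t * infsum A UNIV)"
      using c t by (simp add: q_def zpow_zz norm_mult norm_power A_def mult_ac)
    thus ?thesis using t by simp
  qed
  have "A n0 > 0" using n0 c by (simp add: A_def)
  define S where "S = infsum A UNIV"
  have S: "S \<ge> A n0" using bound[of 1] by (simp add: S_def)
  have "A n0 / (2 * S) * S = A n0 / 2" using S \<open>A n0 > 0\<close> by simp
  moreover have "A n0 \<le> A n0 / (2 * S) * S"
    unfolding S_def using S \<open>A n0 > 0\<close> by (intro bound) (auto simp: S_def[symmetric] field_simps)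
  ultimately show False using \<open>A n0 > 0\<close> by simp
qed

section \<open>The space \<open>H\<^sup>2\<close>\<close>

definition fock_coeffs :: "(('d::finite \<Rightarrow> nat) \<Rightarrow> complex) set" where
  "fock_coeffs = {a. (\<lambda>n. (cmod (a n))\<^sup>2 * fock_weight n) summable_on UNIV}"

text \<open>The functions in \<open>H\<^sup>2\<close> live on the open unit ball; they are extended by \<open>0\<close> so that they can be
  represented by total functions.  They are the sums of the power series \<open>\<Sum> a\<^sub>n z\<^sup>n\<close> with
  \<open>\<Sum> \<bar>a\<^sub>n\<bar>\<^sup>2 \<parallel>z\<^sup>n\<parallel>\<^sup>2 < \<infinity>\<close>, which converge absolutely on the ball.\<close>
definition is_fock_series :: "(('d::finite \<Rightarrow> nat) \<Rightarrow> complex) \<Rightarrow> (complex ^ 'd \<Rightarrow> complex) \<Rightarrow> bool" where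
  "is_fock_series a f \<longleftrightarrow> a \<in> fock_coeffs \<and>
     (\<forall>z\<in>ball 0 1. ((\<lambda>n. a n * zpow z n) has_sum f z) UNIV) \<and> (\<forall>z. z \<notin> ball 0 1 \<longrightarrow> f z = 0)"

lemma fock_coeffs_scale: "a \<in> fock_coeffs \<Longrightarrow> (\<lambda>n. c * a n) \<in> fock_coeffs"
  unfolding fock_coeffs_def
  by (auto simp: norm_mult power_mult_distrib mult.assoc intro: summable_on_cmult_right)

lemma fock_coeffs_add:
  assumes "a \<in> fock_coeffs" "b \<in> fock_coeffs"
  shows "(\<lambda>n. a n + b n) \<in> fock_coeffs"
proof -
  have "(\<lambda>n. 2 * ((cmod (a n))\<^sup>2 * fock_weight n) + 2 * ((cmod (b n))\<^sup>2 * fock_weight n)) summable_on UNIV"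
    using assms unfolding fock_coeffs_def
    by (intro summable_on_add summable_on_cmult_right) auto
  moreover have "(cmod (a n + b n))\<^sup>2 * fock_weight n \<le>
      2 * ((cmod (a n))\<^sup>2 * fock_weight n) + 2 * ((cmod (b n))\<^sup>2 * fock_weight n)" for n
  proof -
    have "(cmod (a n + b n))\<^sup>2 \<le> (cmod (a n) + cmod (b n))\<^sup>2"
      by (intro power_mono norm_triangle_ineq) auto
    also have "\<dots> \<le> 2 * (cmod (a n))\<^sup>2 + 2 * (cmod (b n))\<^sup>2"
      using sum_squares_bound[of "cmod (a n)" "cmod (b n)"] by (simp add: power2_sum)
    finally have "(cmod (a n + b n))\<^sup>2 * fock_weight n \<le> (2 * (cmod (a n))\<^sup>2 + 2 * (cmod (b n))\<^sup>2) * fock_weight n"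
      by (intro mult_right_mono) auto
    thus ?thesis by (simp add: algebra_simps)
  qed
  ultimately show ?thesis unfolding fock_coeffs_def mem_Collect_eq
    by (rule summable_on_comparison_test) auto
qed

lemma fock_coeffs_zero: "(\<lambda>_. 0) \<in> fock_coeffs"
  by (simp add: fock_coeffs_def)

lemma is_fock_series_scale: "is_fock_series a f \<Longrightarrow> is_fock_series (\<lambda>n. c * a n) (\<lambda>z. c * f z)"
  unfolding is_fock_series_def by (auto simp: fock_coeffs_scale mult.assoc intro!: has_sum_cmult_right)

lemma is_fock_series_add:
  "is_fock_series a f \<Longrightarrow> is_fock_series b g \<Longrightarrow> is_fock_series (\<lambda>n. a n + b n) (\<lambda>z. f z + g z)"
  unfolding is_fock_series_def by (auto simp: fock_coeffs_add distrib_right intro!: has_sum_add)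

lemma is_fock_series_zero: "is_fock_series (\<lambda>_. 0) (\<lambda>_. 0)"
  unfolding is_fock_series_def by (auto simp: fock_coeffs_zero)

lemma is_fock_series_unique:
  assumes "is_fock_series a f" "is_fock_series b f"
  shows "a = b"
proof
  fix n
  have "is_fock_series (\<lambda>n. a n + - 1 * b n) (\<lambda>z. f z + - 1 * f z)"
    by (intro is_fock_series_add is_fock_series_scale assms)
  hence "((\<lambda>n. (a n + - 1 * b n) * zpow z n) has_sum (f z + - 1 * f z)) UNIV" if "z \<in> ball 0 1" for z
    using that unfolding is_fock_series_def by blast
  hence "((\<lambda>n. (a n + - 1 * b n) * zpow z n) has_sum 0) UNIV" if "z \<in> ball 0 1" for z
    using that by simp
  hence "a n + - 1 * b n = 0" by (rule fock_series_zero)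
  thus "a n = b n" by simp
qed

lemma is_fock_series_exists:
  assumes "a \<in> fock_coeffs"
  shows "is_fock_series a (\<lambda>z. if z \<in> ball 0 1 then \<Sum>\<^sub>\<infinity>n. a n * zpow z n else 0)"
  unfolding is_fock_series_def
proof (intro conjI ballI)
  fix z :: "complex ^ 'a" assume z: "z \<in> ball 0 1"
  have "(\<lambda>n. (cmod (a n))\<^sup>2 * fock_weight n) summable_on UNIV"
    using assms by (simp add: fock_coeffs_def)
  hence "(\<lambda>n. a n * zpow z n) summable_on UNIV"
    by (rule abs_summable_summable[OF fock_series_abs_summable[OF _ z]])
  thus "((\<lambda>n. a n * zpow z n) has_sum (if z \<in> ball 0 1 then \<Sum>\<^sub>\<infinity>n. a n * zpow z n else 0)) UNIV"
    using z by simp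
qed (use assms in auto)

typedef ('d::finite) fock = "{f :: complex ^ 'd \<Rightarrow> complex. \<exists>a. is_fock_series a f}"
  morphisms fock_eval Abs_fock
  using is_fock_series_zero by blast

definition fock_coeff :: "('d::finite) fock \<Rightarrow> ('d \<Rightarrow> nat) \<Rightarrow> complex" where
  "fock_coeff f = (THE a. is_fock_series a (fock_eval f))"

lemma fock_coeff_eqI: "is_fock_series a (fock_eval f) \<Longrightarrow> fock_coeff f = a"
  unfolding fock_coeff_def by (rule the_equality) (auto intro: is_fock_series_unique)

lemma is_fock_series_coeff: "is_fock_series (fock_coeff f) (fock_eval f)"
proof -
  obtain a where "is_fock_series a (fock_eval f)" using fock_eval[of f] by auto
  thus ?thesis by (simp add: fock_coeff_eqI)
qed

lemma fock_coeff_in: "fock_coeff f \<in> fock_coeffs"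
  using is_fock_series_coeff by (auto simp: is_fock_series_def)

lemma fock_eval_Abs: "is_fock_series a f \<Longrightarrow> fock_eval (Abs_fock f) = f"
  by (rule Abs_fock_inverse) auto

lemma fock_coeff_Abs: "is_fock_series a f \<Longrightarrow> fock_coeff (Abs_fock f) = a"
  by (rule fock_coeff_eqI) (simp add: fock_eval_Abs)

lemma fock_coeff_inject: "fock_coeff f = fock_coeff g \<longleftrightarrow> f = g"
proof
  assume eq: "fock_coeff f = fock_coeff g"
  have "fock_eval f z = fock_eval g z" for z
  proof (cases "z \<in> ball 0 1")
    case True
    hence "((\<lambda>n. fock_coeff g n * zpow z n) has_sum fock_eval f z) UNIV"
      "((\<lambda>n. fock_coeff g n * zpow z n) has_sum fock_eval g z) UNIV"
      using is_fock_series_coeff[of f] is_fock_series_coeff[of g] unfolding eq is_fock_series_def by blast+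
    thus ?thesis by (rule has_sum_unique)
  next
    case False
    thus ?thesis
      using is_fock_series_coeff[of f] is_fock_series_coeff[of g] by (simp add: is_fock_series_def)
  qed
  thus "f = g" by (simp add: fock_eval_inject[symmetric] fun_eq_iff)
qed auto

lemma fock_coeff_surj:
  assumes "a \<in> fock_coeffs"
  obtains f where "fock_coeff f = a"
  by (rule that[OF fock_coeff_Abs[OF is_fock_series_exists[OF assms]]])

instantiation fock :: (finite) real_vector
begin

definition zero_fock :: "'a fock" where "0 = Abs_fock (\<lambda>_. 0)"
definition plus_fock :: "'a fock \<Rightarrow> 'a fock \<Rightarrow> 'a fock" where
  "f + g = Abs_fock (\<lambda>z. fock_eval f z + fock_eval g z)"
definition uminus_fock :: "'a fock \<Rightarrow> 'a fock" where
  "- f = Abs_fock (\<lambda>z. - fock_eval f z)"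
definition minus_fock :: "'a fock \<Rightarrow> 'a fock \<Rightarrow> 'a fock" where
  "f - g = Abs_fock (\<lambda>z. fock_eval f z - fock_eval g z)"
definition scaleR_fock :: "real \<Rightarrow> 'a fock \<Rightarrow> 'a fock" where
  "r *\<^sub>R f = Abs_fock (\<lambda>z. of_real r * fock_eval f z)"

lemma fock_coeff_zero [simp]: "fock_coeff (0 :: 'a fock) n = 0"
  by (simp add: zero_fock_def fock_coeff_Abs[OF is_fock_series_zero])

lemma fock_coeff_add [simp]: "fock_coeff (f + g :: 'a fock) n = fock_coeff f n + fock_coeff g n"
  by (simp add: plus_fock_def
      fock_coeff_Abs[OF is_fock_series_add[OF is_fock_series_coeff is_fock_series_coeff]])

lemma fock_coeff_uminus [simp]: "fock_coeff (- f :: 'a fock) n = - fock_coeff f n"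
  using fock_coeff_Abs[OF is_fock_series_scale[OF is_fock_series_coeff[of f], of "- 1"]]
  by (simp add: uminus_fock_def)

lemma fock_coeff_diff [simp]: "fock_coeff (f - g :: 'a fock) n = fock_coeff f n - fock_coeff g n"
  using fock_coeff_Abs[OF is_fock_series_add[OF is_fock_series_coeff[of f]
        is_fock_series_scale[OF is_fock_series_coeff[of g], of "- 1"]]]
  by (simp add: minus_fock_def)

lemma fock_coeff_scaleR [simp]: "fock_coeff (r *\<^sub>R f :: 'a fock) n = of_real r * fock_coeff f n"
  by (simp add: scaleR_fock_def fock_coeff_Abs[OF is_fock_series_scale[OF is_fock_series_coeff]])

instance
  by standard (auto simp: fock_coeff_inject[symmetric] fun_eq_iff algebra_simps)

end

lemma fock_ip_summable:
  "(\<lambda>n. fock_coeff f n * cnj (fock_coeff g n) * complex_of_real (fock_weight n)) summable_on UNIV"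
proof (rule abs_summable_summable, rule summable_on_comparison_test)
  show "(\<lambda>n. (cmod (fock_coeff f n))\<^sup>2 * fock_weight n + (cmod (fock_coeff g n))\<^sup>2 * fock_weight n) summable_on UNIV"
    using fock_coeff_in[of f] fock_coeff_in[of g] by (intro summable_on_add) (auto simp: fock_coeffs_def)
  fix n
  define u v where "u = cmod (fock_coeff f n)" and "v = cmod (fock_coeff g n)"
  have "0 \<le> u * v" by (simp add: u_def v_def)
  hence "u * v \<le> u\<^sup>2 + v\<^sup>2" using sum_squares_bound[of u v] by linarith
  hence "u * v * fock_weight n \<le> (u\<^sup>2 + v\<^sup>2) * fock_weight n"
    by (intro mult_right_mono) auto
  thus "norm (fock_coeff f n * cnj (fock_coeff g n) * complex_of_real (fock_weight n)) \<le>
      (cmod (fock_coeff f n))\<^sup>2 * fock_weight n + (cmod (fock_coeff g n))\<^sup>2 * fock_weight n"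
    by (simp add: u_def v_def norm_mult distrib_right)
qed auto

definition fock_ip :: "('d::finite) fock \<Rightarrow> 'd fock \<Rightarrow> complex" where
  "fock_ip f g = (\<Sum>\<^sub>\<infinity>n. fock_coeff f n * cnj (fock_coeff g n) * complex_of_real (fock_weight n))"

lemma fock_ip_commute: "fock_ip f g = cnj (fock_ip g f)"
  unfolding fock_ip_def infsum_cnj[symmetric] by (simp add: mult.commute)

lemma fock_ip_add_left: "fock_ip (f + g) h = fock_ip f h + fock_ip g h"
  unfolding fock_ip_def infsum_add[OF fock_ip_summable fock_ip_summable, symmetric]
  by (simp add: distrib_right)

lemma fock_ip_scale_left:
  assumes "\<And>n. fock_coeff g n = c * fock_coeff f n"
  shows "fock_ip g h = c * fock_ip f h"
  unfolding fock_ip_def infsum_cmult_right[OF fock_ip_summable, symmetric] assms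
  by (simp add: mult.assoc)

lemma fock_ip_self: "Re (fock_ip f f) = (\<Sum>\<^sub>\<infinity>n. (cmod (fock_coeff f n))\<^sup>2 * fock_weight n)"
  unfolding fock_ip_def infsum_Re[OF fock_ip_summable, symmetric]
  by (simp add: complex_mult_cnj cmod_power2)

instantiation fock :: (finite) real_inner
begin

definition inner_fock :: "'a fock \<Rightarrow> 'a fock \<Rightarrow> real" where
  "inner f g = Re (fock_ip f g)"
definition norm_fock :: "'a fock \<Rightarrow> real" where
  "norm f = sqrt (inner f (f :: 'a fock))"
definition dist_fock :: "'a fock \<Rightarrow> 'a fock \<Rightarrow> real" where
  "dist f g = norm (f - g :: 'a fock)"
definition sgn_fock :: "'a fock \<Rightarrow> 'a fock" where
  "sgn f = (f :: 'a fock) /\<^sub>R norm f"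
definition uniformity_fock :: "('a fock \<times> 'a fock) filter" where
  "uniformity = (INF e\<in>{0<..}. principal {(f, g :: 'a fock). dist f g < e})"
definition open_fock :: "'a fock set \<Rightarrow> bool" where
  "open (U :: 'a fock set) \<longleftrightarrow> (\<forall>f\<in>U. \<forall>\<^sub>F (f', g) in uniformity. f' = f \<longrightarrow> g \<in> U)"

instance
proof
  fix f g h :: "'a fock" and r :: real
  show "inner f g = inner g f"
    unfolding inner_fock_def by (subst fock_ip_commute) simp
  show "inner (f + g) h = inner f h + inner g h"
    by (simp add: inner_fock_def fock_ip_add_left)
  show "inner (r *\<^sub>R f) g = r * inner f g"
    by (simp add: inner_fock_def fock_ip_scale_left[of "r *\<^sub>R f" "of_real r" f])
  show "0 \<le> inner f f"
    unfolding inner_fock_def fock_ip_self by (intro infsum_nonneg) auto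
  show "inner f f = 0 \<longleftrightarrow> f = 0"
  proof
    assume "inner f f = 0"
    hence 0: "(\<Sum>\<^sub>\<infinity>n. (cmod (fock_coeff f n))\<^sup>2 * fock_weight n) = 0"
      by (simp add: inner_fock_def fock_ip_self)
    have "(cmod (fock_coeff f n))\<^sup>2 * fock_weight n = 0" for n
      by (rule nonneg_infsum_le_0D[where f = "\<lambda>n. (cmod (fock_coeff f n))\<^sup>2 * fock_weight n" and A = UNIV])
        (use 0 fock_coeff_in[of f] in \<open>auto simp: fock_coeffs_def\<close>)
    thus "f = 0" by (auto simp: fock_coeff_inject[symmetric] fun_eq_iff)
  qed (simp add: inner_fock_def fock_ip_def)
qed (simp_all add: norm_fock_def dist_fock_def sgn_fock_def uniformity_fock_def open_fock_def)

end

lemma norm_fock_sq: "(norm f)\<^sup>2 = (\<Sum>\<^sub>\<infinity>n. (cmod (fock_coeff f n))\<^sup>2 * fock_weight n)"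
  by (simp add: power2_norm_eq_inner inner_fock_def fock_ip_self)

lemma fock_coeff_finite_sum_le:
  assumes "finite F"
  shows "(\<Sum>n\<in>F. (cmod (fock_coeff f n))\<^sup>2 * fock_weight n) \<le> (norm f)\<^sup>2"
  unfolding norm_fock_sq
  by (rule finite_sum_le_infsum) (use assms fock_coeff_in[of f] in \<open>auto simp: fock_coeffs_def\<close>)

lemma fock_coeff_bound: "cmod (fock_coeff f n) \<le> norm f / sqrt (fock_weight n)"
proof -
  have "(cmod (fock_coeff f n))\<^sup>2 * fock_weight n \<le> (norm f)\<^sup>2"
    using fock_coeff_finite_sum_le[of "{n}" f] by simp
  hence "sqrt ((cmod (fock_coeff f n))\<^sup>2 * fock_weight n) \<le> sqrt ((norm f)\<^sup>2)"
    by (rule real_sqrt_le_mono)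
  thus ?thesis by (simp add: real_sqrt_mult field_simps)
qed

instance fock :: (finite) complete_space
proof
  fix X :: "nat \<Rightarrow> 'a fock" assume X: "Cauchy X"
  have "Cauchy (\<lambda>j. fock_coeff (X j) n)" for n
  proof (rule metric_CauchyI)
    fix e :: real assume e: "e > 0"
    hence "e * sqrt (fock_weight n) > 0" by simp
    then obtain N where N: "\<And>i j. i \<ge> N \<Longrightarrow> j \<ge> N \<Longrightarrow> dist (X i) (X j) < e * sqrt (fock_weight n)"
      using metric_CauchyD[OF X] by blast
    have "dist (fock_coeff (X i) n) (fock_coeff (X j) n) < e" if "i \<ge> N" "j \<ge> N" for i j
    proof -
      have "dist (fock_coeff (X i) n) (fock_coeff (X j) n) \<le> dist (X i) (X j) / sqrt (fock_weight n)"
        using fock_coeff_bound[of "X i - X j" n] by (simp add: dist_norm)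
      also have "\<dots> < e" using N[OF that] by (simp add: field_simps)
      finally show ?thesis .
    qed
    thus "\<exists>M. \<forall>m\<ge>M. \<forall>k\<ge>M. dist (fock_coeff (X m) n) (fock_coeff (X k) n) < e" by blast
  qed
  hence "\<exists>l. (\<lambda>j. fock_coeff (X j) n) \<longlonglongrightarrow> l" for n
    by (simp add: Cauchy_convergent_iff convergent_def)
  then obtain a where a: "\<And>n. (\<lambda>j. fock_coeff (X j) n) \<longlonglongrightarrow> a n" by metis
  have key: "\<exists>N. \<forall>i\<ge>N. \<forall>F. finite F \<longrightarrow>
      (\<Sum>n\<in>F. (cmod (fock_coeff (X i) n - a n))\<^sup>2 * fock_weight n) \<le> e\<^sup>2" if e: "e > 0" for e :: real
  proof -
    obtain N where N: "\<And>i j. i \<ge> N \<Longrightarrow> j \<ge> N \<Longrightarrow> dist (X i) (X j) < e"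
      using metric_CauchyD[OF X e] by blast
    have "(\<Sum>n\<in>F. (cmod (fock_coeff (X i) n - a n))\<^sup>2 * fock_weight n) \<le> e\<^sup>2"
      if i: "i \<ge> N" and F: "finite F" for i F
    proof (rule tendsto_upperbound)
      show "(\<lambda>j. \<Sum>n\<in>F. (cmod (fock_coeff (X i) n - fock_coeff (X j) n))\<^sup>2 * fock_weight n)
          \<longlonglongrightarrow> (\<Sum>n\<in>F. (cmod (fock_coeff (X i) n - a n))\<^sup>2 * fock_weight n)"
        by (intro tendsto_intros a)
      show "\<forall>\<^sub>F j in sequentially.
          (\<Sum>n\<in>F. (cmod (fock_coeff (X i) n - fock_coeff (X j) n))\<^sup>2 * fock_weight n) \<le> e\<^sup>2"
        using eventually_ge_at_top[of N]
      proof eventually_elim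
        case (elim j)
        have "(norm (X i - X j))\<^sup>2 \<le> e\<^sup>2"
          using N[OF i elim] by (intro power_mono) (auto simp: dist_norm)
        thus ?case using fock_coeff_finite_sum_le[OF F, of "X i - X j"] by simp
      qed
    qed auto
    thus ?thesis by blast
  qed
  obtain N where N: "\<And>F. finite F \<Longrightarrow>
      (\<Sum>n\<in>F. (cmod (fock_coeff (X N) n - a n))\<^sup>2 * fock_weight n) \<le> 1\<^sup>2"
    using key[OF zero_less_one] by blast
  have "(\<lambda>n. fock_coeff (X N) n - a n) \<in> fock_coeffs" unfolding fock_coeffs_def mem_Collect_eq
    by (rule nonneg_bdd_above_summable_on) (use N in \<open>auto intro!: bdd_aboveI[of _ 1]\<close>)
  from fock_coeffs_add[OF fock_coeff_in[of "X N"] fock_coeffs_scale[OF this, of "- 1"]]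
  have "a \<in> fock_coeffs" by simp
  then obtain f where f: "fock_coeff f = a" by (rule fock_coeff_surj)
  have "X \<longlonglongrightarrow> f"
  proof (rule metric_LIMSEQ_I)
    fix e :: real assume e: "e > 0"
    hence "e / 2 > 0" by simp
    from key[OF this] obtain N where N: "\<And>i F. i \<ge> N \<Longrightarrow> finite F \<Longrightarrow>
        (\<Sum>n\<in>F. (cmod (fock_coeff (X i) n - a n))\<^sup>2 * fock_weight n) \<le> (e / 2)\<^sup>2"
      by blast
    have "dist (X i) f < e" if i: "i \<ge> N" for i
    proof -
      have "(norm (X i - f))\<^sup>2 \<le> (e / 2)\<^sup>2"
        unfolding norm_fock_sq
        by (rule infsum_le_finite_sums)
          (use fock_coeff_in[of "X i - f"] N[OF i] f in \<open>auto simp: fock_coeffs_def\<close>)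
      hence "norm (X i - f) \<le> e / 2" by (rule power2_le_imp_le) (use e in auto)
      thus ?thesis using e by (simp add: dist_norm)
    qed
    thus "\<exists>N. \<forall>i\<ge>N. dist (X i) f < e" by blast
  qed
  thus "convergent X" by (auto simp: convergent_def)
qed

instantiation fock :: (finite) complex_hilbert
begin

definition scaleC_fock :: "complex \<Rightarrow> 'a fock \<Rightarrow> 'a fock" where
  "c *\<^sub>C f = Abs_fock (\<lambda>z. c * fock_eval f z)"
definition cinner_fock :: "'a fock \<Rightarrow> 'a fock \<Rightarrow> complex" where
  "cinner f g = fock_ip f g"

lemma fock_coeff_scaleC [simp]: "fock_coeff (c *\<^sub>C f :: 'a fock) n = c * fock_coeff f n"
  by (simp add: scaleC_fock_def fock_coeff_Abs[OF is_fock_series_scale[OF is_fock_series_coeff]])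

instance
proof
  fix f g h :: "'a fock" and b c :: complex and r :: real
  show "c *\<^sub>C (f + g) = c *\<^sub>C f + c *\<^sub>C g" "(b + c) *\<^sub>C f = b *\<^sub>C f + c *\<^sub>C f"
    "b *\<^sub>C c *\<^sub>C f = (b * c) *\<^sub>C f" "r *\<^sub>R f = complex_of_real r *\<^sub>C f"
    by (simp_all add: fock_coeff_inject[symmetric] fun_eq_iff algebra_simps)
  show "cinner f g = cnj (cinner g f)" unfolding cinner_fock_def by (rule fock_ip_commute)
  show "cinner (c *\<^sub>C f) g = c * cinner f g"
    unfolding cinner_fock_def by (rule fock_ip_scale_left) simp
qed (simp_all add: cinner_fock_def inner_fock_def fock_ip_add_left)

end

section \<open>Monomials and the \<open>d\<close>-shift\<close>

lemma mi_shift_inj: "inj (\<lambda>m :: 'd::finite \<Rightarrow> nat. m(k := Suc (m k)))"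
proof (rule injI)
  fix m m' :: "'d \<Rightarrow> nat" assume eq: "m(k := Suc (m k)) = m'(k := Suc (m' k))"
  show "m = m'"
  proof
    fix i show "m i = m' i" using fun_cong[OF eq, of i] by (cases "i = k") auto
  qed
qed

lemma mi_shift_range: "n \<in> range (\<lambda>m :: 'd::finite \<Rightarrow> nat. m(k := Suc (m k))) \<longleftrightarrow> n k \<noteq> 0"
proof
  assume "n k \<noteq> 0"
  hence "n = (\<lambda>m. m(k := Suc (m k))) (n(k := n k - 1))" by auto
  thus "n \<in> range (\<lambda>m. m(k := Suc (m k)))" by blast
qed auto

lemma fock_weight_shift_le: "fock_weight (n(k := Suc (n k))) \<le> fock_weight n"
proof -
  have "n k \<le> mi_deg n" unfolding mi_deg_def by (intro member_le_sum) auto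
  hence "real (Suc (n k)) / real (Suc (mi_deg n)) \<le> 1" by simp
  thus ?thesis unfolding fock_weight_upd by (intro mult_left_le) auto
qed

definition mi_shift :: "'d::finite \<Rightarrow> (('d \<Rightarrow> nat) \<Rightarrow> complex) \<Rightarrow> ('d \<Rightarrow> nat) \<Rightarrow> complex" where
  "mi_shift k a n = (if n k = 0 then 0 else a (n(k := n k - 1)))"

lemma mi_shift_upd [simp]: "mi_shift k a (n(k := Suc (n k))) = a n"
  by (simp add: mi_shift_def)

lemma mi_shift_has_sum:
  fixes k :: "'d::finite"
  assumes "\<And>n. n k = 0 \<Longrightarrow> g n = 0"
  shows "(g has_sum S) UNIV \<longleftrightarrow> ((\<lambda>m. g (m(k := Suc (m k)))) has_sum S) UNIV"
proof -
  have "(g has_sum S) UNIV \<longleftrightarrow> (g has_sum S) (range (\<lambda>m. m(k := Suc (m k))))"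
  proof (rule has_sum_cong_neutral)
    fix n :: "'d \<Rightarrow> nat" assume "n \<in> UNIV - range (\<lambda>m. m(k := Suc (m k)))"
    hence "n k = 0" using mi_shift_range[of n k] by blast
    thus "g n = 0" by (rule assms)
  qed simp_all
  also have "\<dots> \<longleftrightarrow> ((\<lambda>m. g (m(k := Suc (m k)))) has_sum S) UNIV"
    by (subst has_sum_reindex[OF mi_shift_inj]) (simp add: o_def)
  finally show ?thesis .
qed

lemma mi_shift_weight_summable:
  assumes "a \<in> fock_coeffs"
  shows "(\<lambda>m. (cmod (a m))\<^sup>2 * fock_weight (m(k := Suc (m k)))) summable_on UNIV"
proof (rule summable_on_comparison_test)
  show "(\<lambda>n. (cmod (a n))\<^sup>2 * fock_weight n) summable_on UNIV"
    using assms by (simp add: fock_coeffs_def)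
  show "(cmod (a m))\<^sup>2 * fock_weight (m(k := Suc (m k))) \<le> (cmod (a m))\<^sup>2 * fock_weight m" for m
    by (intro mult_left_mono fock_weight_shift_le) auto
qed auto

lemma mi_shift_weight_has_sum:
  assumes "a \<in> fock_coeffs"
  shows "((\<lambda>n. (cmod (mi_shift k a n))\<^sup>2 * fock_weight n) has_sum
    (\<Sum>\<^sub>\<infinity>m. (cmod (a m))\<^sup>2 * fock_weight (m(k := Suc (m k))))) UNIV"
proof (subst mi_shift_has_sum[of k])
  show "((\<lambda>m. (cmod (mi_shift k a (m(k := Suc (m k)))))\<^sup>2 * fock_weight (m(k := Suc (m k)))) has_sum
      (\<Sum>\<^sub>\<infinity>m. (cmod (a m))\<^sup>2 * fock_weight (m(k := Suc (m k))))) UNIV"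
    using has_sum_infsum[OF mi_shift_weight_summable[OF assms]] by (simp only: mi_shift_upd)
qed (simp add: mi_shift_def)

lemma is_fock_series_shift:
  assumes "is_fock_series a f"
  shows "is_fock_series (mi_shift k a) (\<lambda>z. z $ k * f z)"
  unfolding is_fock_series_def
proof (intro conjI ballI allI impI)
  have a: "a \<in> fock_coeffs" using assms by (simp add: is_fock_series_def)
  show "mi_shift k a \<in> fock_coeffs"
    using has_sum_imp_summable[OF mi_shift_weight_has_sum[OF a]] by (simp add: fock_coeffs_def)
  fix z :: "complex ^ 'a"
  show "((\<lambda>n. mi_shift k a n * zpow z n) has_sum (z $ k * f z)) UNIV" if z: "z \<in> ball 0 1"
  proof (subst mi_shift_has_sum[of k])
    have "((\<lambda>n. a n * zpow z n) has_sum f z) UNIV" using assms z unfolding is_fock_series_def by blast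
    from has_sum_cmult_right[OF this, of "z $ k"]
    show "((\<lambda>m. mi_shift k a (m(k := Suc (m k))) * zpow z (m(k := Suc (m k)))) has_sum (z $ k * f z)) UNIV"
      by (simp only: mi_shift_upd zpow_upd mult_ac)
  qed (simp add: mi_shift_def)
  show "z $ k * f z = 0" if "z \<notin> ball 0 1"
    using assms that by (simp add: is_fock_series_def)
qed

definition coord_mult :: "'d::finite \<Rightarrow> 'd fock \<Rightarrow> 'd fock" where
  "coord_mult k f = Abs_fock (\<lambda>z. z $ k * fock_eval f z)"

lemma fock_eval_coord_mult: "fock_eval (coord_mult k f) z = z $ k * fock_eval f z"
  unfolding coord_mult_def
  by (simp add: fock_eval_Abs[OF is_fock_series_shift[OF is_fock_series_coeff]])

lemma fock_coeff_coord_mult: "fock_coeff (coord_mult k f) = mi_shift k (fock_coeff f)"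
  unfolding coord_mult_def
  by (rule fock_coeff_Abs[OF is_fock_series_shift[OF is_fock_series_coeff]])

lemma norm_coord_mult_le: "norm (coord_mult k f) \<le> norm f"
proof (rule power2_le_imp_le)
  have "(norm (coord_mult k f))\<^sup>2 =
      (\<Sum>\<^sub>\<infinity>m. (cmod (fock_coeff f m))\<^sup>2 * fock_weight (m(k := Suc (m k))))"
    unfolding norm_fock_sq fock_coeff_coord_mult
    by (rule infsumI[OF mi_shift_weight_has_sum[OF fock_coeff_in]])
  also have "\<dots> \<le> (norm f)\<^sup>2"
    unfolding norm_fock_sq
  proof (rule infsum_mono[OF mi_shift_weight_summable[OF fock_coeff_in]])
    show "(\<lambda>n. (cmod (fock_coeff f n))\<^sup>2 * fock_weight n) summable_on UNIV"
      using fock_coeff_in[of f] by (simp add: fock_coeffs_def)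
    show "(cmod (fock_coeff f m))\<^sup>2 * fock_weight (m(k := Suc (m k))) \<le>
        (cmod (fock_coeff f m))\<^sup>2 * fock_weight m" for m
      by (intro mult_left_mono fock_weight_shift_le) auto
  qed
  finally show "(norm (coord_mult k f))\<^sup>2 \<le> (norm f)\<^sup>2" .
qed auto

lemma coord_mult_add: "coord_mult k (f + g) = coord_mult k f + coord_mult k g"
  by (simp add: fock_coeff_inject[symmetric] fun_eq_iff fock_coeff_coord_mult mi_shift_def)

lemma coord_mult_scaleC: "coord_mult k (c *\<^sub>C f) = c *\<^sub>C coord_mult k f"
  by (simp add: fock_coeff_inject[symmetric] fun_eq_iff fock_coeff_coord_mult mi_shift_def)

definition fock_monomial :: "('d::finite \<Rightarrow> nat) \<Rightarrow> 'd fock" where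
  "fock_monomial n = Abs_fock (\<lambda>z. if z \<in> ball 0 1 then zpow z n else 0)"

lemma is_fock_series_monomial:
  "is_fock_series (\<lambda>m. if m = n then 1 else 0) (\<lambda>z. if z \<in> ball 0 1 then zpow z n else 0)"
  unfolding is_fock_series_def
proof (intro conjI ballI)
  show "(\<lambda>m. if m = n then 1 else 0) \<in> fock_coeffs"
    unfolding fock_coeffs_def mem_Collect_eq
    by (rule has_sum_imp_summable[OF has_sum_finite_neutralI[of "{n}"]]) auto
  show "((\<lambda>m. (if m = n then 1 else 0) * zpow z m) has_sum
      (if z \<in> ball 0 1 then zpow z n else 0)) UNIV" if "z \<in> ball 0 1" for z :: "complex ^ 'a"
    using that by (intro has_sum_finite_neutralI[of "{n}"]) auto
qed auto

lemma fock_coeff_monomial: "fock_coeff (fock_monomial n) m = (if m = n then 1 else 0)"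
  unfolding fock_monomial_def fock_coeff_Abs[OF is_fock_series_monomial] ..

lemma fock_eval_monomial: "z \<in> ball 0 1 \<Longrightarrow> fock_eval (fock_monomial n) z = (\<Prod>i\<in>UNIV. (z $ i) ^ n i)"
  unfolding fock_monomial_def fock_eval_Abs[OF is_fock_series_monomial] by (simp add: zpow_def)

lemma cinner_fock_monomial_left:
  "cinner (fock_monomial n) f = cnj (fock_coeff f n) * complex_of_real (fock_weight n)"
  unfolding cinner_fock_def fock_ip_def
  by (rule infsumI[OF has_sum_finite_neutralI[of "{n}"]]) (auto simp: fock_coeff_monomial)

text \<open>The monomials are orthogonal with the prescribed norms, and their span is dense; this determines
  \<open>H\<^sup>2\<close>.\<close>
lemma cinner_fock_monomials:
  "cinner (fock_monomial m) (fock_monomial n) =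
     (if m = n then (\<Prod>i\<in>UNIV. fact (n i)) / fact (\<Sum>i\<in>UNIV. n i) else 0)"
  by (simp add: cinner_fock_monomial_left fock_coeff_monomial fock_weight_def mi_deg_def)

lemma fock_coeff_sum: "fock_coeff (\<Sum>x\<in>F. g x) n = (\<Sum>x\<in>F. fock_coeff (g x) n)"
  by (induction F rule: infinite_finite_induct) auto

lemma fock_monomials_dense: "closure (complex_vector.span (range fock_monomial)) = UNIV"
proof -
  have "f \<in> closure (complex_vector.span (range fock_monomial))" for f :: "'a fock"
  proof (unfold closure_approachable, intro allI impI)
    fix e :: real assume e: "e > 0"
    define h where "h n = (cmod (fock_coeff f n))\<^sup>2 * fock_weight n" for n
    have h: "(h has_sum (norm f)\<^sup>2) UNIV"
      using fock_coeff_in[of f] unfolding h_def norm_fock_sq fock_coeffs_def by simp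
    have "e\<^sup>2 / 4 > 0" using e by simp
    from has_sum_finite_approximation[OF h this]
    obtain F where F: "finite F" "dist (sum h F) ((norm f)\<^sup>2) \<le> e\<^sup>2 / 4" by blast
    define g where "g = (\<Sum>n\<in>F. fock_coeff f n *\<^sub>C fock_monomial n)"
    have g_span: "g \<in> complex_vector.span (range fock_monomial)"
      unfolding g_def
      by (intro complex_vector.span_sum complex_vector.span_scale complex_vector.span_base) auto
    have g_coeff: "fock_coeff (g - f) n = (if n \<in> F then 0 else - fock_coeff f n)" for n
      using F(1) by (simp add: g_def fock_coeff_sum fock_coeff_monomial if_distrib cong: if_cong)
    have "((\<lambda>n. if n \<in> F then h n else 0) has_sum sum h F) UNIV"
      by (rule has_sum_finite_neutralI[OF F(1)]) auto
    from has_sum_add[OF h has_sum_uminusI[OF this]]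
    have "((\<lambda>n. h n + - (if n \<in> F then h n else 0)) has_sum (norm f)\<^sup>2 - sum h F) UNIV" by simp
    also have "(\<lambda>n. h n + - (if n \<in> F then h n else 0)) =
        (\<lambda>n. (cmod (fock_coeff (g - f) n))\<^sup>2 * fock_weight n)"
      unfolding g_coeff by (auto simp: h_def)
    finally have "(norm (g - f))\<^sup>2 = (norm f)\<^sup>2 - sum h F"
      unfolding norm_fock_sq[of "g - f"] by (rule infsumI)
    also have "\<dots> \<le> e\<^sup>2 / 4" using F(2) unfolding dist_real_def by linarith
    also have "e\<^sup>2 / 4 = (e / 2)\<^sup>2" by (simp add: power_divide)
    finally have "norm (g - f) \<le> e / 2" by (rule power2_le_imp_le) (use e in auto)
    hence "dist g f < e" using e by (simp add: dist_norm)
    thus "\<exists>y\<in>complex_vector.span (range fock_monomial). dist y f < e" using g_span by blast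
  qed
  thus ?thesis by blast
qed

text \<open>\<open>H\<^sup>2 \<otimes> \<complex>\<^sup>r\<close> is represented by the \<open>r\<close>-tuples of elements of \<open>H\<^sup>2\<close>, with \<open>f \<otimes> \<zeta>\<close> corresponding to
  \<open>(\<zeta>\<^sub>1 f, \<dots>, \<zeta>\<^sub>r f)\<close>.\<close>
definition fock_tensor :: "('d::finite) fock \<Rightarrow> complex ^ 'r::finite \<Rightarrow> 'd fock ^ 'r" where
  "fock_tensor f \<zeta> = (\<chi> i. (\<zeta> $ i) *\<^sub>C f)"

definition d_shift :: "'d::finite \<Rightarrow> 'd fock ^ 'r::finite \<Rightarrow> 'd fock ^ 'r" where
  "d_shift k F = (\<chi> i. coord_mult k (F $ i))"

lemma cinner_fock_tensor:
  "cinner (fock_tensor f \<zeta>) (fock_tensor g \<eta>) = cinner f g * (\<Sum>i\<in>UNIV. \<zeta> $ i * cnj (\<eta> $ i))"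
proof -
  have "cinner (c *\<^sub>C f) (d *\<^sub>C g) = cinner f g * (c * cnj d)" for c d
    by (subst cinner_scaleC_left, subst cinner_commute, subst cinner_scaleC_left,
        subst (2) cinner_commute) simp
  thus ?thesis by (simp add: cinner_vec_def fock_tensor_def sum_distrib_left)
qed

lemma d_shift_tensor: "d_shift k (fock_tensor f \<zeta>) = fock_tensor (coord_mult k f) \<zeta>"
  by (simp add: d_shift_def fock_tensor_def vec_eq_iff coord_mult_scaleC)

lemma bounded_linear_d_shift: "bounded_linear (d_shift k)"
proof (rule bounded_linear_intro[where K = 1])
  fix F G :: "'a fock ^ 'b" and r :: real
  show "d_shift k (F + G) = d_shift k F + d_shift k G"
    by (simp add: d_shift_def vec_eq_iff coord_mult_add)
  show "d_shift k (r *\<^sub>R F) = r *\<^sub>R d_shift k F"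
    by (simp add: d_shift_def vec_eq_iff scaleR_scaleC scaleC_vec_def coord_mult_scaleC)
  show "norm (d_shift k F) \<le> norm F * 1"
    by (simp add: d_shift_def norm_vec_def L2_set_mono norm_coord_mult_le)
qed

definition closed_invariant_subspace :: "(('d::finite) fock ^ 'r::finite) set \<Rightarrow> bool" where
  "closed_invariant_subspace M \<longleftrightarrow>
     complex_vector.subspace M \<and> closed M \<and> (\<forall>k. d_shift k ` M \<subseteq> M)"

definition monomials :: "(('d::finite) fock ^ 'r::finite) set" where
  "monomials = {fock_tensor (fock_monomial n) \<zeta> |n \<zeta>. True}"

end

theory Submission
  imports Defs
begin

text \<open>Put \<open>V\<^sub>n = {\<zeta>. z\<^sup>n \<otimes> \<zeta> \<in> M}\<close>.  As \<open>M\<close> is generated by monomials, \<open>P\<^sub>M\<close> acts on the coefficient at \<open>n\<close> as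
  the projection \<open>P\<^sub>n\<close> onto \<open>V\<^sub>n\<close>, so the commutator maps \<open>z\<^sup>n \<otimes> \<zeta>\<close> to \<open>z\<^sup>m \<otimes> (P\<^sub>m - P\<^sub>n) \<zeta>\<close>, where \<open>m\<close> is \<open>n\<close>
  with its \<open>k\<close>-th entry increased by one.  It therefore has the singular values
  \<open>\<surd>((n\<^sub>k + 1) / (\<bar>n\<bar> + 1))\<close> with multiplicities \<open>dim V\<^sub>m - dim V\<^sub>n \<le> r\<close>.  The spaces \<open>V\<^sub>n\<close> increase
  with \<open>n\<close>, so by Dickson's lemma a proper inclusion of \<open>V\<^sub>n\<close> in \<open>V\<^sub>m\<close> is only possible for bounded \<open>n\<^sub>k\<close>.  Hence
  the \<open>p\<close>-th powers of the singular values are dominated by a multiple of the sum over all \<open>n\<close> of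
  \<open>(\<bar>n\<bar> + 1)\<^sup>-\<^sup>p\<^sup>/\<^sup>2\<close>, which converges for \<open>p / 2 > d\<close>.\<close>

section \<open>Projections and adjoints\<close>

text \<open>With this instance the coefficient space \<open>\<complex>\<^sup>r\<close> is a Hilbert space of the same class as \<open>H\<^sup>2 \<otimes> \<complex>\<^sup>r\<close>.\<close>
instantiation complex :: complex_hilbert
begin

definition scaleC_complex :: "complex \<Rightarrow> complex \<Rightarrow> complex" where
  "scaleC_complex c x = c * x"

definition cinner_complex :: "complex \<Rightarrow> complex \<Rightarrow> complex" where
  "cinner_complex x y = x * cnj y"

instance
  by standard
    (auto simp: scaleC_complex_def cinner_complex_def algebra_simps scaleR_conv_of_real
      inner_complex_def)

end

section \<open>Calculus of the complex inner product\<close>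

lemma
  fixes x y z :: "'a::complex_hilbert"
  shows cinner_add_right: "cinner x (y + z) = cinner x y + cinner x z"
    and cinner_scaleC_right: "cinner x (c *\<^sub>C y) = cnj c * cinner x y"
    and cinner_zero_left [simp]: "cinner 0 x = 0"
    and cinner_zero_right [simp]: "cinner x 0 = 0"
    and cinner_diff_left: "cinner (x - y) z = cinner x z - cinner y z"
    and cinner_diff_right: "cinner x (y - z) = cinner x y - cinner x z"
    and cinner_eq_0_commute: "cinner x y = 0 \<longleftrightarrow> cinner y x = 0"
proof -
  show add_right: "cinner x (y + z) = cinner x y + cinner x z" for x y z :: 'a
    by (subst (1 2 3) cinner_commute) (simp add: cinner_add_left)
  show "cinner x (c *\<^sub>C y) = cnj c * cinner x y"
    by (subst (1 2) cinner_commute) (simp add: cinner_scaleC_left)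
  show "cinner 0 x = 0" "cinner x 0 = 0"
    using cinner_add_left[of 0 0 x] add_right[of x 0 0] by auto
  show "cinner (x - y) z = cinner x z - cinner y z"
    using cinner_add_left[of "x - y" y z] by simp
  show "cinner x (y - z) = cinner x y - cinner x z"
    using add_right[of x "y - z" z] by simp
  show "cinner x y = 0 \<longleftrightarrow> cinner y x = 0"
    by (subst cinner_commute) simp
qed

lemma cinner_sum_left: "cinner (\<Sum>i\<in>I. f i) x = (\<Sum>i\<in>I. cinner (f i) x)"
  for x :: "'a::complex_hilbert"
  by (induction I rule: infinite_finite_induct) (auto simp: cinner_add_left)

lemma cinner_sum_right: "cinner x (\<Sum>i\<in>I. f i) = (\<Sum>i\<in>I. cinner x (f i))"
  for x :: "'a::complex_hilbert"
  by (induction I rule: infinite_finite_induct) (auto simp: cinner_add_right)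

lemma cinner_self_eq_0 [simp]: "cinner x x = 0 \<longleftrightarrow> x = 0" for x :: "'a::complex_hilbert"
  by (simp add: cinner_self)

lemma cinner_conv_inner: "cinner x y = Complex (inner x y) (inner x (\<i> *\<^sub>C y))"
  for x :: "'a::complex_hilbert"
  by (simp add: complex_eq_iff inner_eq_Re_cinner cinner_scaleC_right)

lemma cinner_eqI:
  fixes x y :: "'a::complex_hilbert"
  assumes "\<And>u. cinner u x = cinner u y"
  shows "x = y"
  using assms[of "x - y"] cinner_self_eq_0[of "x - y"] by (simp add: cinner_diff_right)

lemma norm_scaleC: "norm (c *\<^sub>C x) = cmod c * norm x" for x :: "'a::complex_hilbert"
proof -
  have "complex_of_real ((norm (c *\<^sub>C x))\<^sup>2) = (c * cnj c) * cinner x x"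
    by (simp only: cinner_self[symmetric] cinner_scaleC_left cinner_scaleC_right mult_ac)
  also have "\<dots> = complex_of_real ((cmod c * norm x)\<^sup>2)"
    by (simp only: complex_norm_square[symmetric] cinner_self power_mult_distrib of_real_mult)
  finally have "(norm (c *\<^sub>C x))\<^sup>2 = (cmod c * norm x)\<^sup>2" using of_real_eq_iff by blast
  thus ?thesis by (simp add: power2_eq_iff_nonneg)
qed

lemma bounded_linear_scaleC: "bounded_linear (\<lambda>c. c *\<^sub>C x)" for x :: "'a::complex_hilbert"
  by (rule bounded_linear_intro[where K = "norm x"])
    (simp_all add: scaleC_add_left scaleR_scaleC[where 'a = 'a] scaleC_scaleC scaleR_conv_of_real norm_scaleC)

lemma bounded_linear_scaleC_right: "bounded_linear (\<lambda>x. c *\<^sub>C x)" for c :: complex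
  by (rule bounded_linear_intro[where K = "cmod c"])
    (simp_all add: scaleC_add_right scaleR_scaleC scaleC_scaleC norm_scaleC mult.commute)

lemma subspace_if_complex_subspace:
  "complex_vector.subspace M \<Longrightarrow> subspace M" for M :: "'a::complex_hilbert set"
  by (auto simp: subspace_def complex_vector.subspace_def scaleR_scaleC)

text \<open>A complex subspace contains \<open>\<i> *\<^sub>C u\<close> along with \<open>u\<close>,
  and real orthogonality to both makes the real and the imaginary part vanish.\<close>

lemma cinner_orthogonal_if_inner:
  fixes M :: "'a::complex_hilbert set"
  assumes "complex_vector.subspace M" "\<And>u. u \<in> M \<Longrightarrow> inner x u = 0" "u \<in> M"
  shows "cinner x u = 0"
  using assms complex_vector.subspace_scale[OF assms(1,3), of \<i>]
  by (simp add: cinner_conv_inner zero_complex.code)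

text \<open>A minimizing sequence for the distance to \<open>S\<close> is Cauchy by the
  parallelogram law, and its limit is the foot of the perpendicular. The real inner product suffices
  for the complex case by \<open>cinner_orthogonal_if_inner\<close>.\<close>

lemma real_projection_exists:
  fixes S :: "'a::{real_inner, complete_space} set"
  assumes S: "subspace S" "closed S"
  obtains y where "y \<in> S" "\<And>u. u \<in> S \<Longrightarrow> inner (x - y) u = 0"
proof -
  define \<delta> where "\<delta> = infdist x S"
  have ne: "S \<noteq> {}" using subspace_0[OF S(1)] by blast
  have lower: "\<delta> \<le> norm (x - u)" if "u \<in> S" for u
    unfolding \<delta>_def dist_norm[symmetric] by (rule infdist_le[OF that])
  have "\<exists>u\<in>S. norm (x - u) < \<delta> + 1 / Suc n" for n
    using cInf_lessD[of "dist x ` S" "\<delta> + 1 / Suc n"] ne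
    by (auto simp: \<delta>_def infdist_notempty dist_norm)
  then obtain u where u: "\<And>n. u n \<in> S" "\<And>n. norm (x - u n) < \<delta> + 1 / Suc n" by metis
  have \<delta>0: "\<delta> \<ge> 0" by (simp add: \<delta>_def infdist_nonneg)
  \<comment> \<open>Parallelogram law for \<open>x - a\<close> and \<open>x - b\<close>. Their sum
    is twice the difference of \<open>x\<close> and the midpoint, which lies in \<open>S\<close> if
    \<open>a\<close> and \<open>b\<close> do.\<close>
  have para: "(norm (a - b))\<^sup>2 = 2 * (norm (x - a))\<^sup>2 + 2 * (norm (x - b))\<^sup>2 - 4 * (norm (x - (1/2) *\<^sub>R (a + b)))\<^sup>2"
    for a b
  proof -
    have "(norm (x - (1/2) *\<^sub>R (a + b)))\<^sup>2 * 4 = (norm (2 *\<^sub>R (x - (1/2) *\<^sub>R (a + b))))\<^sup>2"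
      by (simp add: power_mult_distrib)
    also have "2 *\<^sub>R (x - (1/2) *\<^sub>R (a + b)) = (x - a) + (x - b)"
      by (simp add: algebra_simps scaleR_2)
    also have "(norm ((x - a) + (x - b)))\<^sup>2 =
        2 * (norm (x - a))\<^sup>2 + 2 * (norm (x - b))\<^sup>2 - (norm ((x - a) - (x - b)))\<^sup>2"
      by (simp add: power2_norm_eq_inner inner_add inner_diff inner_commute algebra_simps)
    also have "norm ((x - a) - (x - b)) = norm (a - b)" by (simp add: norm_minus_commute)
    finally show ?thesis by simp
  qed
  have "Cauchy u"
  proof (rule metric_CauchyI)
    fix e :: real assume e: "e > 0"
    \<comment> \<open>\<open>h N\<close> is the bound that the parallelogram law leaves for the
      squared distance of two members from index \<open>N\<close> on, as their midpoint has distance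
      at least \<open>\<delta>\<close> from \<open>x\<close>.\<close>
    define h where "h n = 4 * ((\<delta> + 1 / Suc n)\<^sup>2 - \<delta>\<^sup>2)" for n
    have "(\<lambda>n. 1 / real (Suc n)) \<longlonglongrightarrow> 0" by (rule LIMSEQ_Suc[OF lim_1_over_n])
    hence "h \<longlonglongrightarrow> 4 * ((\<delta> + 0)\<^sup>2 - \<delta>\<^sup>2)" unfolding h_def by (intro tendsto_intros)
    hence "h \<longlonglongrightarrow> 0" by simp
    hence "\<forall>\<^sub>F n in sequentially. h n < e\<^sup>2" by (rule order_tendstoD) (use e in simp)
    then obtain N where N: "h N < e\<^sup>2" by (auto simp: eventually_sequentially)
    have "dist (u m) (u n) < e" if mn: "m \<ge> N" "n \<ge> N" for m n
    proof -
      have b: "(norm (x - u i))\<^sup>2 \<le> (\<delta> + 1 / Suc N)\<^sup>2" if "i \<ge> N" for i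
      proof (rule power_mono)
        have "1 / real (Suc i) \<le> 1 / Suc N" using that by (intro divide_left_mono) auto
        thus "norm (x - u i) \<le> \<delta> + 1 / Suc N" using u(2)[of i] by linarith
      qed simp
      have "\<delta> \<le> norm (x - (1/2) *\<^sub>R (u m + u n))"
        by (intro lower subspace_scale[OF S(1)] subspace_add[OF S(1)] u)
      hence "\<delta>\<^sup>2 \<le> (norm (x - (1/2) *\<^sub>R (u m + u n)))\<^sup>2" using \<delta>0 by (intro power_mono)
      hence "(norm (u m - u n))\<^sup>2 \<le> h N"
        using para[of "u m" "u n"] b[OF mn(1)] b[OF mn(2)] by (simp add: h_def)
      hence "(norm (u m - u n))\<^sup>2 < e\<^sup>2" using N by linarith
      thus ?thesis unfolding dist_norm by (rule power2_less_imp_less) (use e in simp)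
    qed
    thus "\<exists>N. \<forall>m\<ge>N. \<forall>n\<ge>N. dist (u m) (u n) < e" by blast
  qed
  then obtain y where y: "u \<longlonglongrightarrow> y" using Cauchy_convergent_iff convergent_def by blast
  have yS: "y \<in> S" by (rule closed_sequentially[OF S(2) _ y]) (use u in blast)
  have "(\<lambda>n. norm (x - u n)) \<longlonglongrightarrow> norm (x - y)" by (intro tendsto_intros y)
  moreover have "(\<lambda>n. \<delta> + 1 / Suc n) \<longlonglongrightarrow> \<delta> + 0"
    by (intro tendsto_intros LIMSEQ_Suc[OF lim_1_over_n])
  ultimately have "norm (x - y) \<le> \<delta> + 0"
    by (rule LIMSEQ_le) (use u(2) less_imp_le in blast)
  hence ny: "norm (x - y) \<le> \<delta>" by simp
  have "inner (x - y) v = 0" if v: "v \<in> S" for v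
  proof (cases "v = 0")
    case False
    \<comment> \<open>This \<open>t\<close> minimizes the quadratic polynomial
      \<open>(norm (x - (y + t v)))^2\<close>, which would fall below the minimal distance if
      \<open>inner (x - y) v\<close> were nonzero.\<close>
    define t where "t = inner (x - y) v / inner v v"
    have "y + t *\<^sub>R v \<in> S" by (intro subspace_add[OF S(1)] subspace_scale[OF S(1)] v yS)
    from lower[OF this] have "norm (x - y) \<le> norm (x - (y + t *\<^sub>R v))" using ny by linarith
    hence "(norm (x - y))\<^sup>2 \<le> (norm (x - (y + t *\<^sub>R v)))\<^sup>2" by (intro power_mono) auto
    also have "x - (y + t *\<^sub>R v) = (x - y) - t *\<^sub>R v" by simp
    also have "(norm ((x - y) - t *\<^sub>R v))\<^sup>2 = (norm (x - y))\<^sup>2 - 2 * t * inner (x - y) v + t\<^sup>2 * inner v v"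
      unfolding power2_norm_eq_inner power2_eq_square[of t]
      by (simp add: inner_diff inner_commute algebra_simps)
    also have "\<dots> = (norm (x - y))\<^sup>2 - (inner (x - y) v)\<^sup>2 / inner v v"
      using False by (simp add: t_def power2_eq_square field_simps)
    finally have "(inner (x - y) v)\<^sup>2 / inner v v \<le> 0" by simp
    moreover have "inner v v > 0" using False by simp
    ultimately show ?thesis
      by (metis divide_pos_pos linorder_not_le zero_less_power2)
  qed simp
  with yS show ?thesis by (rule that)
qed

text \<open>The orthogonal complement of the kernel of a nonzero functional is a line. It is spanned
  by what remains of any \<open>w\<close> with \<open>g w \<noteq> 0\<close> after projection onto
  the kernel.\<close>

lemma riesz_representation:
  fixes g :: "'a::{real_inner, complete_space} \<Rightarrow> real"
  assumes g: "bounded_linear g"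
  obtains z where "\<And>x. g x = inner x z"
proof (cases "\<forall>x. g x = 0")
  case True
  thus ?thesis using that[of 0] by simp
next
  case False
  then obtain w where w: "g w \<noteq> 0" by blast
  interpret g: bounded_linear g by (rule g)
  have K: "subspace {x. g x = 0}" by (auto simp: subspace_def g.add g.scaleR)
  have "closed (g -` {0})" by (intro closed_vimage closed_singleton linear_continuous_on[OF g])
  hence "closed {x. g x = 0}" by (simp add: vimage_def)
  from real_projection_exists[OF K this, of w]
  obtain y where y: "g y = 0" "\<And>u. g u = 0 \<Longrightarrow> inner (w - y) u = 0" by auto
  define v where "v = w - y"
  have gv: "g v \<noteq> 0" using w y(1) by (simp add: v_def g.diff)
  have "g x = inner x ((g v / inner v v) *\<^sub>R v)" for x
  proof -
    \<comment> \<open>Subtracting this multiple of \<open>v\<close> moves \<open>x\<close> into the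
      kernel, to which \<open>v\<close> is orthogonal.\<close>
    have "inner v (x - (g x / g v) *\<^sub>R v) = 0"
      unfolding v_def by (rule y(2)) (use gv in \<open>simp add: g.diff g.scaleR flip: v_def\<close>)
    moreover have "inner v v \<noteq> 0" using gv g.zero by auto
    ultimately show ?thesis using gv by (simp add: inner_diff_right field_simps inner_commute)
  qed
  thus ?thesis by (rule that)
qed

text \<open>Two candidates differ by an element of \<open>M\<close> that is orthogonal to itself, so
  exhibiting one candidate resolves the definite description.\<close>

lemma orth_proj_eqI:
  fixes M :: "'a::complex_hilbert set"
  assumes "complex_vector.subspace M" "y \<in> M" "\<And>u. u \<in> M \<Longrightarrow> cinner (x - y) u = 0"
  shows "orth_proj M x = y"
  unfolding orth_proj_def
proof (rule the_equality)
  fix z assume z: "z \<in> M \<and> (\<forall>u\<in>M. cinner (x - z) u = 0)"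
  have "y - z \<in> M" using assms z by (intro complex_vector.subspace_diff) auto
  hence "cinner (x - z) (y - z) - cinner (x - y) (y - z) = 0" using assms z by simp
  hence "cinner (y - z) (y - z) = 0" by (simp add: cinner_diff_left)
  thus "z = y" by simp
qed (use assms in auto)

locale closed_complex_subspace =
  fixes M :: "'a::complex_hilbert set"
  assumes sub: "complex_vector.subspace M" and clo: "closed M"
begin

lemma orth_proj_props: "orth_proj M x \<in> M" "u \<in> M \<Longrightarrow> cinner (x - orth_proj M x) u = 0"
proof -
  obtain y where y: "y \<in> M" "\<And>u. u \<in> M \<Longrightarrow> inner (x - y) u = 0"
    using real_projection_exists[OF subspace_if_complex_subspace[OF sub] clo] by blast
  have "orth_proj M x = y" "u \<in> M \<Longrightarrow> cinner (x - y) u = 0" for u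
    by (rule orth_proj_eqI[OF sub y(1)]) (use cinner_orthogonal_if_inner[OF sub y(2)] in auto)
  thus "orth_proj M x \<in> M" "u \<in> M \<Longrightarrow> cinner (x - orth_proj M x) u = 0" using y by auto
qed

lemma orth_proj_id: "x \<in> M \<Longrightarrow> orth_proj M x = x"
  by (rule orth_proj_eqI[OF sub]) auto

lemma orth_proj_eq_0: "(\<And>u. u \<in> M \<Longrightarrow> cinner x u = 0) \<Longrightarrow> orth_proj M x = 0"
  by (rule orth_proj_eqI[OF sub]) (auto intro: complex_vector.subspace_0[OF sub])

lemma orth_proj_add: "orth_proj M (x + y) = orth_proj M x + orth_proj M y"
proof (rule orth_proj_eqI[OF sub complex_vector.subspace_add[OF sub]])
  fix u assume "u \<in> M"
  hence "cinner ((x - orth_proj M x) + (y - orth_proj M y)) u = 0"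
    by (simp add: cinner_add_left orth_proj_props)
  thus "cinner (x + y - (orth_proj M x + orth_proj M y)) u = 0"
    by (simp add: algebra_simps)
qed (rule orth_proj_props)+

lemma orth_proj_scaleC: "orth_proj M (c *\<^sub>C x) = c *\<^sub>C orth_proj M x"
proof (rule orth_proj_eqI[OF sub complex_vector.subspace_scale[OF sub]])
  fix u assume "u \<in> M"
  hence "c * cinner (x - orth_proj M x) u = 0" by (simp add: orth_proj_props)
  thus "cinner (c *\<^sub>C x - c *\<^sub>C orth_proj M x) u = 0"
    by (simp add: cinner_diff_left cinner_scaleC_left algebra_simps)
qed (rule orth_proj_props)

lemma cinner_orth_proj_left: "u \<in> M \<Longrightarrow> cinner (orth_proj M x) u = cinner x u"
  using orth_proj_props(2)[of u x] by (simp add: cinner_diff_left)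

lemma cinner_orth_proj_commute: "cinner (orth_proj M x) y = cinner x (orth_proj M y)"
proof -
  have "cinner (orth_proj M x) y = cnj (cinner (orth_proj M y) (orth_proj M x))"
    by (subst cinner_commute) (simp add: cinner_orth_proj_left orth_proj_props)
  also have "\<dots> = cinner (orth_proj M x) (orth_proj M y)" by (rule cinner_commute[symmetric])
  also have "\<dots> = cinner x (orth_proj M y)" by (intro cinner_orth_proj_left orth_proj_props)
  finally show ?thesis .
qed

lemma norm_orth_proj_le: "norm (orth_proj M x) \<le> norm x"
proof (cases "orth_proj M x = 0")
  case False
  have "(norm (orth_proj M x))\<^sup>2 = Re (cinner (orth_proj M x) (orth_proj M x))"
    by (simp add: cinner_self)
  also have "\<dots> = inner x (orth_proj M x)"
    by (simp add: cinner_orth_proj_left orth_proj_props inner_eq_Re_cinner)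
  also have "\<dots> \<le> norm x * norm (orth_proj M x)" by (rule norm_cauchy_schwarz)
  finally show ?thesis using False by (simp add: power2_eq_square)
qed simp

lemma bounded_linear_orth_proj: "bounded_linear (orth_proj M)"
  by (rule bounded_linear_intro[where K = 1])
    (simp_all add: orth_proj_add scaleR_scaleC orth_proj_scaleC norm_orth_proj_le)

end

text \<open>Riesz representation yields an adjoint, and \<open>cinner_eqI\<close> makes it the only
  one, which resolves the definite description.\<close>

lemma hilbert_adjoint_eq:
  fixes T :: "'a::complex_hilbert \<Rightarrow> 'a"
  assumes T: "bounded_linear T" "\<And>c x. T (c *\<^sub>C x) = c *\<^sub>C T x"
  shows "cinner (T x) y = cinner x (hilbert_adjoint T y)"
proof -
  have "\<exists>z. \<forall>x. cinner (T x) y = cinner x z" for y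
  proof -
    have "bounded_linear (\<lambda>x. inner (T x) y)"
      by (rule bounded_linear_compose[OF bounded_linear_inner_left T(1)])
    then obtain z where z: "\<And>x. inner (T x) y = inner x z" using riesz_representation by blast
    \<comment> \<open>Replacing \<open>x\<close> by \<open>\<i> *\<^sub>C x\<close> turns equality
      of real parts into equality of imaginary parts.\<close>
    have "Im (cinner (T x) y) = Im (cinner x z)" for x
      using z[of "\<i> *\<^sub>C x"] by (simp add: inner_eq_Re_cinner T(2) cinner_scaleC_left)
    with z have "cinner (T x) y = cinner x z" for x
      by (simp add: complex_eq_iff inner_eq_Re_cinner)
    thus ?thesis by blast
  qed
  then obtain A where A: "\<And>x y. cinner (T x) y = cinner x (A y)" by metis
  have "hilbert_adjoint T = A"
    unfolding hilbert_adjoint_def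
  proof (rule the_equality)
    show "\<forall>x y. cinner (T x) y = cinner x (A y)" using A by blast
    fix B assume B: "\<forall>x y. cinner (T x) y = cinner x (B y)"
    have "cinner x (B y) = cinner x (A y)" for x y using A B by metis
    thus "B = A" by (blast intro: cinner_eqI)
  qed
  thus ?thesis using A by simp
qed

section \<open>A criterion for membership in a Schatten class\<close>

text \<open>\<open>s\<close> is the generalized inverse of the function \<open>N\<close> that counts
  the indices with \<open>\<sigma> i \<ge> t\<close>. Its superlevel sets are initial segments of
  length \<open>N t\<close>, and multiplicities arise by subtracting the counts for strict from
  those for weak inequality.\<close>

lemma decreasing_rearrangement:
  fixes \<sigma> :: "'i \<Rightarrow> real"
  assumes fin: "\<And>t. t > 0 \<Longrightarrow> finite {i\<in>I. t \<le> \<sigma> i}"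
  obtains s :: "nat \<Rightarrow> real" where "decseq s" "\<And>n. 0 \<le> s n"
    "\<And>t. t > 0 \<Longrightarrow> finite {n. s n = t}"
    "\<And>t. t > 0 \<Longrightarrow> card {n. s n = t} = card {i\<in>I. \<sigma> i = t}"
proof -
  define N where "N t = card {i\<in>I. t \<le> \<sigma> i}" for t
  have N_anti: "N t' \<le> N t" if "0 < t" "t \<le> t'" for t t'
    unfolding N_def using that by (intro card_mono fin) auto
  \<comment> \<open>The inserted \<open>0\<close> becomes the value \<open>s n\<close> when at most
    \<open>n\<close> indices have a positive \<open>\<sigma> i\<close>.\<close>
  define X where "X n = insert 0 {t. 0 < t \<and> n < N t}" for n
  define s where "s n = Sup (X n)" for n
  have bdd: "bdd_above (X n)" for n
  proof (rule bdd_aboveI)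
    fix t assume t: "t \<in> X n"
    \<comment> \<open>A \<open>t > 1\<close> in \<open>X n\<close> lies below some
      \<open>\<sigma> i\<close>, hence below the largest of the finitely many values that are at
      least 1.\<close>
    define b where "b = Max (insert 1 (\<sigma> ` {i\<in>I. 1 \<le> \<sigma> i}))"
    have fin1: "finite (insert 1 (\<sigma> ` {i\<in>I. 1 \<le> \<sigma> i}))" using fin[of 1] by simp
    have b1: "1 \<le> b" unfolding b_def by (rule Max_ge[OF fin1]) simp
    show "t \<le> b"
    proof (cases "t \<le> 1")
      case False
      hence "N t > 0" using t by (auto simp: X_def)
      then obtain i where "i \<in> I" "t \<le> \<sigma> i" unfolding N_def by (auto simp: card_gt_0_iff)
      moreover from this have "\<sigma> i \<le> b"
        unfolding b_def using False by (intro Max_ge[OF fin1]) auto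
      ultimately show ?thesis by linarith
    qed (use b1 in simp)
  qed
  have s_ge: "t \<le> s n" if "0 < t" "n < N t" for t n
    unfolding s_def by (rule cSup_upper[OF _ bdd]) (use that in \<open>auto simp: X_def\<close>)
  have s_nonneg: "0 \<le> s n" for n
    unfolding s_def by (rule cSup_upper[OF _ bdd]) (simp add: X_def)
  \<comment> \<open>\<open>N\<close> is left-continuous, so the supremum defining \<open>s n\<close> is attained.\<close>
  have N_less: "n < N t" if t: "0 < t" "t \<le> s n" for t n
  proof (rule ccontr)
    assume n: "\<not> n < N t"
    define F where "F = insert (t / 2) (\<sigma> ` {i\<in>I. t / 2 \<le> \<sigma> i \<and> \<sigma> i < t})"
    have "finite {i\<in>I. t / 2 \<le> \<sigma> i \<and> \<sigma> i < t}"
      by (rule finite_subset[OF _ fin[of "t / 2"]]) (use t in auto)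
    hence F: "finite F" by (simp add: F_def)
    \<comment> \<open>No value of \<open>\<sigma>\<close> lies in \<open>[t', t)\<close>, so
      \<open>N\<close> is constant from \<open>t'\<close> to \<open>t\<close>. The element
      \<open>t / 2\<close> of \<open>F\<close> keeps \<open>t'\<close> positive.\<close>
    define t' where "t' = (Max F + t) / 2"
    have "Max F \<in> F" by (rule Max_in[OF F]) (simp add: F_def)
    hence "Max F < t" using t by (auto simp: F_def)
    moreover have half: "t / 2 \<le> Max F" by (rule Max_ge[OF F]) (simp add: F_def)
    ultimately have t': "0 < t'" "t' < t" "Max F < t'" using t by (auto simp: t'_def field_simps)
    have "t \<le> \<sigma> i" if i: "i \<in> I" "t' \<le> \<sigma> i" for i
    proof (rule ccontr)
      assume "\<not> t \<le> \<sigma> i"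
      hence "\<sigma> i \<in> F" using i t' half by (auto simp: F_def)
      thus False using Max_ge[OF F, of "\<sigma> i"] i t' by linarith
    qed
    hence "{i\<in>I. t' \<le> \<sigma> i} = {i\<in>I. t \<le> \<sigma> i}" using t' by auto
    hence Nt': "N t' \<le> n" using n by (simp add: N_def)
    have "u \<le> t'" if "u \<in> X n" for u
    proof (rule ccontr)
      assume u: "\<not> u \<le> t'"
      hence "n < N u" using that t' by (auto simp: X_def)
      moreover have "N u \<le> N t'" using u t' by (intro N_anti) auto
      ultimately show False using Nt' by linarith
    qed
    hence "s n \<le> t'" unfolding s_def by (intro cSup_least) (auto simp: X_def)
    thus False using t t' by linarith
  qed
  have level: "{n. t \<le> s n} = {..<card {i\<in>I. t \<le> \<sigma> i}}" if "0 < t" for t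
    using s_ge[OF that] N_less[OF that] by (auto simp: N_def)
  have strict_level: "{n. t < s n} = {..<card {i\<in>I. t < \<sigma> i}}" if t: "0 < t" for t
  proof -
    \<comment> \<open>\<open>Min F\<close> is a threshold above \<open>t\<close> that selects the
      same indices as the strict inequality; \<open>t + 1\<close> keeps \<open>F\<close>
      nonempty.\<close>
    define F where "F = insert (t + 1) (\<sigma> ` {i\<in>I. t < \<sigma> i})"
    have "finite {i\<in>I. t < \<sigma> i}" by (rule finite_subset[OF _ fin[OF t]]) auto
    hence F: "finite F" by (simp add: F_def)
    have "Min F \<in> F" by (rule Min_in[OF F]) (simp add: F_def)
    hence tF: "t < Min F" by (auto simp: F_def)
    have eq: "{i\<in>I. t < \<sigma> i} = {i\<in>I. Min F \<le> \<sigma> i}"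
      using tF Min_le[OF F] by (force simp: F_def)
    show ?thesis
    proof (intro set_eqI iffI)
      fix n assume "n \<in> {n. t < s n}"
      hence ts: "t < s n" by simp
      hence "n < N (s n)" using N_less[of "s n" n] t by simp
      also have "\<dots> \<le> card {i\<in>I. t < \<sigma> i}"
        unfolding N_def using ts \<open>finite {i\<in>I. t < \<sigma> i}\<close> by (intro card_mono) auto
      finally show "n \<in> {..<card {i\<in>I. t < \<sigma> i}}" by simp
    next
      fix n assume "n \<in> {..<card {i\<in>I. t < \<sigma> i}}"
      hence "Min F \<le> s n" using s_ge[of "Min F" n] t tF by (simp add: eq N_def)
      thus "n \<in> {n. t < s n}" using tF by simp
    qed
  qed
  show ?thesis
  proof (rule that[of s])
    show "decseq s"
    proof (rule antimonoI)
      fix m n :: nat assume mn: "m \<le> n"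
      show "s n \<le> s m"
      proof (cases "s n > 0")
        case True
        thus ?thesis using mn N_less[OF True order.refl] by (intro s_ge) auto
      qed (use s_nonneg[of m] in simp)
    qed
    show "0 \<le> s n" for n by (rule s_nonneg)
    fix t :: real assume t: "t > 0"
    have split: "{n. s n = t} = {n. t \<le> s n} - {n. t < s n}" by auto
    show "finite {n. s n = t}" unfolding split level[OF t] by simp
    have fin': "finite {i\<in>I. t < \<sigma> i}" by (rule finite_subset[OF _ fin[OF t]]) auto
    have "card {n. s n = t} = card {i\<in>I. t \<le> \<sigma> i} - card {i\<in>I. t < \<sigma> i}"
      unfolding split level[OF t] strict_level[OF t]
      by (subst card_Diff_subset) (auto intro: order_less_le_trans card_mono[OF fin[OF t]])
    also have "\<dots> = card ({i\<in>I. t \<le> \<sigma> i} - {i\<in>I. t < \<sigma> i})"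
      by (rule card_Diff_subset[symmetric]) (use fin' in auto)
    also have "{i\<in>I. t \<le> \<sigma> i} - {i\<in>I. t < \<sigma> i} = {i\<in>I. \<sigma> i = t}" by auto
    finally show "card {n. s n = t} = card {i\<in>I. \<sigma> i = t}" .
  qed
qed

text \<open>Bijections between the level sets for all \<open>t > 0\<close> glue to a
  value-preserving injection of the positive positions of \<open>s\<close> into \<open>I\<close>, so
  the nonzero terms form a subfamily of a summable one.\<close>

lemma summable_powr_rearrangement:
  fixes \<sigma> :: "'i \<Rightarrow> real" and s :: "nat \<Rightarrow> real"
  assumes "\<And>n. 0 \<le> s n"
    and fin: "\<And>t. t > 0 \<Longrightarrow> finite {n. s n = t}" "\<And>t. t > 0 \<Longrightarrow> finite {i\<in>I. \<sigma> i = t}"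
    and card_eq: "\<And>t. t > 0 \<Longrightarrow> card {n. s n = t} = card {i\<in>I. \<sigma> i = t}"
    and sum: "(\<lambda>i. \<sigma> i powr p) summable_on I"
  shows "summable (\<lambda>n. s n powr p)"
proof -
  have "\<exists>g. bij_betw g {n. s n = t} {i\<in>I. \<sigma> i = t}" if "t > 0" for t
    using that by (intro finite_same_card_bij fin card_eq)
  then obtain g where g: "\<And>t. t > 0 \<Longrightarrow> bij_betw (g t) {n. s n = t} {i\<in>I. \<sigma> i = t}" by metis
  define h where "h n = g (s n) n" for n
  define P where "P = {n. s n > 0}"
  have h: "h n \<in> I \<and> \<sigma> (h n) = s n" if "n \<in> P" for n
    using bij_betwE[OF g[of "s n"]] that by (auto simp: P_def h_def)
  have inj: "inj_on h P"
  proof (rule inj_onI)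
    fix m n assume mn: "m \<in> P" "n \<in> P" "h m = h n"
    hence s: "s m = s n" using h by metis
    have "inj_on (g (s n)) {k. s k = s n}" using g[of "s n"] mn by (auto simp: bij_betw_def P_def)
    thus "m = n" using mn(3) s by (auto simp: h_def inj_on_def)
  qed
  have "(\<lambda>i. \<sigma> i powr p) summable_on h ` P"
    by (rule summable_on_subset_banach[OF sum]) (use h in auto)
  hence "((\<lambda>i. \<sigma> i powr p) \<circ> h) summable_on P"
    using summable_on_reindex[OF inj] by blast
  also have "?this \<longleftrightarrow> (\<lambda>n. s n powr p) summable_on UNIV"
  proof (rule summable_on_cong_neutral)
    fix n assume "n \<in> UNIV - P"
    hence "s n = 0" using assms(1)[of n] by (simp add: P_def)
    thus "s n powr p = 0" by simp
  qed (use h in auto)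
  finally show ?thesis by (rule summable_on_imp_summable)
qed

section \<open>Orthonormal families and their finite linear combinations\<close>

definition orthonormal :: "'i set \<Rightarrow> ('i \<Rightarrow> 'a::complex_hilbert) \<Rightarrow> bool" where
  "orthonormal I e \<longleftrightarrow> (\<forall>i\<in>I. \<forall>j\<in>I. cinner (e i) (e j) = (if i = j then 1 else 0))"

lemma orthonormal_subset: "orthonormal I e \<Longrightarrow> J \<subseteq> I \<Longrightarrow> orthonormal J e"
  unfolding orthonormal_def by blast

lemma cinner_orthonormal_sum:
  assumes "orthonormal I e" "finite J" "J \<subseteq> I" "i \<in> I"
  shows "cinner (\<Sum>j\<in>J. c j *\<^sub>C e j) (e i) = (if i \<in> J then c i else 0)"
proof -
  have "cinner (\<Sum>j\<in>J. c j *\<^sub>C e j) (e i) = (\<Sum>j\<in>J. if j = i then c i else 0)"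
    unfolding cinner_sum_left using assms
    by (intro sum.cong refl) (auto simp: cinner_scaleC_left orthonormal_def subset_iff)
  thus ?thesis using assms(2) by simp
qed

lemma norm_orthonormal_sum:
  assumes "orthonormal J e" "finite J"
  shows "(norm (\<Sum>j\<in>J. c j *\<^sub>C e j))\<^sup>2 = (\<Sum>j\<in>J. (cmod (c j))\<^sup>2)"
proof -
  define x where "x = (\<Sum>j\<in>J. c j *\<^sub>C e j)"
  have "complex_of_real ((norm x)\<^sup>2) = (\<Sum>j\<in>J. cnj (c j) * cinner x (e j))"
    unfolding cinner_self[symmetric] by (subst (2) x_def) (simp add: cinner_sum_right cinner_scaleC_right)
  also have "\<dots> = (\<Sum>j\<in>J. complex_of_real ((cmod (c j))\<^sup>2))"
    unfolding x_def complex_norm_square using cinner_orthonormal_sum[OF assms order.refl]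
    by (intro sum.cong refl) (simp add: mult.commute)
  also have "\<dots> = complex_of_real (\<Sum>j\<in>J. (cmod (c j))\<^sup>2)" by simp
  finally show ?thesis unfolding x_def of_real_eq_iff .
qed

lemma orthonormal_inj_on: "orthonormal J e \<Longrightarrow> inj_on e J"
  unfolding orthonormal_def by (rule inj_onI) (metis one_neq_zero)

lemma orthonormal_independent:
  assumes "orthonormal J e" "finite J"
  shows "complex_vector.independent (e ` J)"
proof (rule complex_vector.independent_if_scalars_zero)
  fix f x assume s: "(\<Sum>x\<in>e ` J. f x *\<^sub>C x) = 0" and "x \<in> e ` J"
  then obtain j where j: "j \<in> J" "x = e j" by blast
  have "(\<Sum>i\<in>J. f (e i) *\<^sub>C e i) = 0"
    using s by (simp add: sum.reindex[OF orthonormal_inj_on[OF assms(1)]])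
  hence "0 = cinner (\<Sum>i\<in>J. f (e i) *\<^sub>C e i) (e j)" by simp
  also have "\<dots> = f (e j)" by (subst cinner_orthonormal_sum[OF assms order.refl j(1)]) (use j in simp)
  finally show "f x = 0" using j by simp
qed (use assms in simp)

text \<open>Injectivity lets the scalars be indexed by \<open>I\<close> instead of by vectors, the
  form in which orthonormality is applied.\<close>

lemma in_span_image_iff:
  assumes "inj_on e I"
  shows "x \<in> complex_vector.span (e ` I) \<longleftrightarrow>
    (\<exists>J c. finite J \<and> J \<subseteq> I \<and> x = (\<Sum>j\<in>J. c j *\<^sub>C e j))"
proof
  assume "x \<in> complex_vector.span (e ` I)"
  then obtain t r where t: "finite t" "t \<subseteq> e ` I" "x = (\<Sum>a\<in>t. r a *\<^sub>C a)"
    unfolding complex_vector.span_explicit by blast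
  from t(2) obtain J where J: "J \<subseteq> I" "t = e ` J" by (meson subset_imageE)
  have inj: "inj_on e J" using assms J(1) by (rule inj_on_subset)
  show "\<exists>J c. finite J \<and> J \<subseteq> I \<and> x = (\<Sum>j\<in>J. c j *\<^sub>C e j)"
    using t J finite_imageD[OF _ inj]
    by (intro exI[of _ J] exI[of _ "\<lambda>j. r (e j)"]) (simp add: sum.reindex[OF inj])
qed (auto intro!: complex_vector.span_sum complex_vector.span_scale intro: complex_vector.span_base)

text \<open>A finite \<open>\<epsilon> / 4\<close>-net of \<open>K\<close> is an
  \<open>\<epsilon>\<close>-net of the closure: the net, the approximation by \<open>K\<close> and
  the passage to the closure each cost at most \<open>\<epsilon> / 4\<close>.\<close>

lemma compact_closure_image_if_approx:
  fixes f :: "'a \<Rightarrow> 'b::complete_space"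
  assumes "\<And>\<epsilon>. \<epsilon> > 0 \<Longrightarrow> \<exists>K. compact K \<and> (\<forall>x\<in>S. \<exists>y\<in>K. dist (f x) y \<le> \<epsilon>)"
  shows "compact (closure (f ` S))"
  unfolding compact_eq_totally_bounded
proof (intro conjI allI impI)
  show "complete (closure (f ` S))" by (simp add: complete_eq_closed)
  fix \<epsilon> :: real assume \<epsilon>: "\<epsilon> > 0"
  then obtain K where K: "compact K" "\<And>x. x \<in> S \<Longrightarrow> \<exists>y\<in>K. dist (f x) y \<le> \<epsilon> / 4"
    using assms[of "\<epsilon> / 4"] by auto
  obtain k where k: "finite k" "K \<subseteq> (\<Union>x\<in>k. ball x (\<epsilon> / 4))"
    using K(1) \<epsilon> unfolding compact_eq_totally_bounded by (meson divide_pos_pos zero_less_numeral)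
  have "closure (f ` S) \<subseteq> (\<Union>x\<in>k. ball x \<epsilon>)"
  proof
    fix z assume "z \<in> closure (f ` S)"
    then obtain x where x: "x \<in> S" "dist (f x) z < \<epsilon> / 4"
      using \<epsilon> by (auto simp: closure_approachable dest: spec[of _ "\<epsilon> / 4"])
    obtain y where y: "y \<in> K" "dist (f x) y \<le> \<epsilon> / 4" using K(2)[OF x(1)] by blast
    obtain w where w: "w \<in> k" "dist w y < \<epsilon> / 4" using k(2) y(1) by auto
    have "dist w z \<le> dist w y + dist y (f x) + dist (f x) z"
      using dist_triangle[of w z y] dist_triangle[of y z "f x"] by linarith
    also have "\<dots> < \<epsilon>" using x y w \<epsilon> by (simp add: dist_commute)
    finally show "z \<in> (\<Union>x\<in>k. ball x \<epsilon>)" using w by auto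
  qed
  thus "\<exists>k. finite k \<and> closure (f ` S) \<subseteq> (\<Union>x\<in>k. ball x \<epsilon>)" using k(1) by blast
qed

text \<open>\<open>K\<close> is a Minkowski sum of compact images of discs, one for each index. It
  will hold the values of the finite-rank part of an operator.\<close>

lemma compact_coefficient_sums:
  fixes v :: "'i \<Rightarrow> 'a::complex_hilbert"
  assumes "finite J"
  shows "\<exists>K. compact K \<and> (\<forall>c. (\<forall>j\<in>J. cmod (c j) \<le> R) \<longrightarrow> (\<Sum>j\<in>J. c j *\<^sub>C v j) \<in> K)"
  using assms
proof (induction J)
  case empty
  thus ?case by (intro exI[of _ "{0}"]) auto
next
  case (insert j J)
  then obtain K where K: "compact K" "\<And>c. (\<forall>j\<in>J. cmod (c j) \<le> R) \<Longrightarrow> (\<Sum>j\<in>J. c j *\<^sub>C v j) \<in> K"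
    by blast
  have "compact ((\<lambda>c. c *\<^sub>C v j) ` cball 0 R)"
    by (intro compact_continuous_image linear_continuous_on bounded_linear_scaleC compact_cball)
  from compact_sums[OF this K(1)]
  show ?case
  proof (rule_tac exI, intro conjI allI impI, assumption)
    fix c :: "'i \<Rightarrow> complex" assume c: "\<forall>i\<in>insert j J. cmod (c i) \<le> R"
    have "(\<Sum>i\<in>insert j J. c i *\<^sub>C v i) = c j *\<^sub>C v j + (\<Sum>i\<in>J. c i *\<^sub>C v i)"
      using insert.hyps by simp
    moreover have "c j *\<^sub>C v j \<in> (\<lambda>c. c *\<^sub>C v j) ` cball 0 R" using c by (intro imageI) simp
    moreover have "(\<Sum>i\<in>J. c i *\<^sub>C v i) \<in> K" using c by (intro K(2)) auto
    ultimately show "(\<Sum>i\<in>insert j J. c i *\<^sub>C v i) \<in>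
        {x + y |x y. x \<in> (\<lambda>c. c *\<^sub>C v j) ` cball 0 R \<and> y \<in> K}" by blast
  qed
qed

text \<open>Multiplying \<open>x\<close> by the conjugate of \<open>cinner x y\<close> makes the
  inner product real, so the real inequality applies.\<close>

lemma cinner_Cauchy_Schwarz: "cmod (cinner x y) \<le> norm x * norm y" for x :: "'a::complex_hilbert"
proof (cases "cinner x y = 0")
  case False
  define a where "a = cinner x y"
  have "(cmod a)\<^sup>2 = Re (cinner (cnj a *\<^sub>C x) y)"
    unfolding cinner_scaleC_left a_def[symmetric] cmod_power2 by (simp add: power2_eq_square)
  also have "\<dots> = inner (cnj a *\<^sub>C x) y" by (simp add: inner_eq_Re_cinner)
  also have "\<dots> \<le> norm (cnj a *\<^sub>C x) * norm y" by (rule norm_cauchy_schwarz)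
  also have "\<dots> = cmod a * (norm x * norm y)" by (simp add: norm_scaleC)
  finally show ?thesis using False by (simp add: power2_eq_square a_def)
qed simp

lemma complex_subspace_closure:
  fixes L :: "'a::complex_hilbert set"
  assumes L: "complex_vector.subspace L"
  shows "complex_vector.subspace (closure L)"
proof (rule complex_vector.subspaceI)
  show "0 \<in> closure L" using complex_vector.subspace_0[OF L] closure_subset by blast
  fix x y assume "x \<in> closure L" "y \<in> closure L"
  then obtain X Y where "\<And>n. X n \<in> L" "\<And>n. Y n \<in> L" "X \<longlonglongrightarrow> x" "Y \<longlonglongrightarrow> y"
    unfolding closure_sequential by blast
  thus "x + y \<in> closure L"
    unfolding closure_sequential
    by (intro exI[of _ "\<lambda>n. X n + Y n"]) (auto intro: tendsto_add complex_vector.subspace_add[OF L])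
next
  fix c and x :: 'a assume x: "x \<in> closure L"
  have "(\<lambda>x. c *\<^sub>C x) ` closure L \<subseteq> closure L"
    by (rule image_closure_subset[OF linear_continuous_on[OF bounded_linear_scaleC_right]])
      (use closure_subset complex_vector.subspace_scale[OF L] in auto)
  thus "c *\<^sub>C x \<in> closure L" using x by blast
qed

text \<open>\<open>eig\<close> is the weak form of
  \<open>T\<^sup>* T e\<^sub>i = \<sigma>\<^sub>i\<^sup>2 e\<^sub>i\<close>, and \<open>ker\<close>
  says that \<open>T\<close> vanishes on the orthogonal complement of all \<open>e i\<close>.
  Together they diagonalize \<open>T\<^sup>* T\<close>, so the nonzero singular values are the
  \<open>\<sigma> i\<close>. Summability leaves only finitely many of them above any
  \<open>t > 0\<close>, whence compactness.\<close>

lemma schatten_classI: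
  fixes T :: "'a::complex_hilbert \<Rightarrow> 'a" and e :: "'i \<Rightarrow> 'a" and \<sigma> :: "'i \<Rightarrow> real"
  assumes T: "bounded_linear T" and T_scale: "\<And>c x. T (c *\<^sub>C x) = c *\<^sub>C T x"
    and on: "orthonormal I e"
    and \<sigma>_pos: "\<And>i. i \<in> I \<Longrightarrow> 0 < \<sigma> i"
    and eig: "\<And>i x. i \<in> I \<Longrightarrow> cinner (T x) (T (e i)) = complex_of_real ((\<sigma> i)\<^sup>2) * cinner x (e i)"
    and ker: "\<And>x. (\<And>i. i \<in> I \<Longrightarrow> cinner x (e i) = 0) \<Longrightarrow> T x = 0"
    and sum: "(\<lambda>i. \<sigma> i powr p) summable_on I" and p: "0 < p"
  shows "T \<in> schatten_class p"
proof -
  interpret T: bounded_linear T by (rule T)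
  note adj = hilbert_adjoint_eq[OF T T_scale]
  \<comment> \<open>Each index in this set contributes at least \<open>t powr p\<close> to a finite
    sum.\<close>
  have fin: "finite {i\<in>I. t \<le> \<sigma> i}" if t: "t > 0" for t
  proof (rule ccontr)
    assume inf: "infinite {i\<in>I. t \<le> \<sigma> i}"
    define C where "C = infsum (\<lambda>i. \<sigma> i powr p) I"
    obtain m :: nat where m: "C / t powr p < m" using reals_Archimedean2 by blast
    obtain F where F: "finite F" "card F = m" "F \<subseteq> {i\<in>I. t \<le> \<sigma> i}"
      using infinite_arbitrarily_large[OF inf] by blast
    have "m * t powr p \<le> (\<Sum>i\<in>F. \<sigma> i powr p)"
      using F t p by (subst F(2)[symmetric], intro sum_bounded_below powr_mono2) auto
    also have "\<dots> \<le> C" unfolding C_def by (rule finite_sum_le_infsum[OF sum]) (use F in auto)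
    finally show False using m t by (simp add: field_simps)
  qed
  have fin_eq: "finite {i\<in>I. \<sigma> i = t}" if "t > 0" for t
    by (rule finite_subset[OF _ fin[OF that]]) auto
  have remainder: "cinner (x - (\<Sum>j\<in>J. cinner x (e j) *\<^sub>C e j)) (e i) = (if i \<in> J then 0 else cinner x (e i))"
    if "finite J" "J \<subseteq> I" "i \<in> I" for x J i
    using cinner_orthonormal_sum[OF on that, of "\<lambda>j. cinner x (e j)"] by (simp add: cinner_diff_left)
  \<comment> \<open>The remainder of \<open>x\<close> after expansion along \<open>J\<close> is
    orthogonal to every \<open>e i\<close>, so \<open>T\<close> annihilates it.\<close>
  have expand: "T x = T (\<Sum>j\<in>J. cinner x (e j) *\<^sub>C e j)"
    if "finite J" "J \<subseteq> I" "\<And>i. i \<in> I - J \<Longrightarrow> cinner x (e i) = 0" for x J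
  proof -
    have "T (x - (\<Sum>j\<in>J. cinner x (e j) *\<^sub>C e j)) = 0"
      by (rule ker) (use remainder[OF that(1,2)] that(3) in auto)
    thus ?thesis by (simp add: T.diff)
  qed
  have eig_sum: "cinner (T x) (T (\<Sum>j\<in>J. c j *\<^sub>C e j)) =
      (\<Sum>j\<in>J. complex_of_real ((\<sigma> j)\<^sup>2) * cnj (c j) * cinner x (e j))" if "J \<subseteq> I" for x J c
    using that by (auto simp: T.sum T_scale cinner_sum_right cinner_scaleC_right eig subset_iff
        mult_ac intro!: sum.cong)

  \<comment> \<open>The eigenspace for \<open>t\<^sup>2\<close> turns out to be the span of the
    independent vectors \<open>e i\<close> with \<open>\<sigma> i = t\<close>.\<close>
  have dim: "complex_vector.dim {x. hilbert_adjoint T (T x) = complex_of_real (t\<^sup>2) *\<^sub>C x} = card {i\<in>I. \<sigma> i = t}"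
    if t: "t > 0" for t
  proof -
    define J where "J = {i\<in>I. \<sigma> i = t}"
    have J: "finite J" "J \<subseteq> I" using fin_eq[OF t] by (auto simp: J_def)
    note onJ = orthonormal_subset[OF on J(2)]
    have ATs: "hilbert_adjoint T (T (\<Sum>j\<in>J. c j *\<^sub>C e j)) = complex_of_real (t\<^sup>2) *\<^sub>C (\<Sum>j\<in>J. c j *\<^sub>C e j)"
      for c
    proof (rule cinner_eqI)
      fix u
      show "cinner u (hilbert_adjoint T (T (\<Sum>j\<in>J. c j *\<^sub>C e j))) =
          cinner u (complex_of_real (t\<^sup>2) *\<^sub>C (\<Sum>j\<in>J. c j *\<^sub>C e j))"
        unfolding adj[symmetric] eig_sum[OF J(2)]
        by (auto simp: cinner_scaleC_right cinner_sum_right sum_distrib_left mult.assoc J_def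
            intro!: sum.cong)
    qed
    have "{x. hilbert_adjoint T (T x) = complex_of_real (t\<^sup>2) *\<^sub>C x} = complex_vector.span (e ` J)"
    proof (intro set_eqI iffI)
      fix x assume "x \<in> {x. hilbert_adjoint T (T x) = complex_of_real (t\<^sup>2) *\<^sub>C x}"
      hence x: "hilbert_adjoint T (T x) = complex_of_real (t\<^sup>2) *\<^sub>C x" by simp
      \<comment> \<open>Eigenvectors for distinct eigenvalues are orthogonal. As \<open>t\<close>
        and \<open>\<sigma> i\<close> are positive and distinct, so are their squares.\<close>
      have "cinner x (e i) = 0" if i: "i \<in> I - J" for i
      proof -
        have "complex_of_real (t\<^sup>2) * cinner (e i) x = cinner (e i) (hilbert_adjoint T (T x))"
          by (simp add: x cinner_scaleC_right)
        also have "\<dots> = cnj (cinner (T x) (T (e i)))"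
          unfolding adj[symmetric] by (rule cinner_commute)
        also have "\<dots> = complex_of_real ((\<sigma> i)\<^sup>2) * cinner (e i) x"
          using i by (simp add: eig) (subst cinner_commute, simp)
        finally have "t\<^sup>2 = (\<sigma> i)\<^sup>2 \<or> cinner (e i) x = 0" by (metis mult_cancel_right of_real_eq_iff)
        moreover have "t\<^sup>2 \<noteq> (\<sigma> i)\<^sup>2" using i t \<sigma>_pos[of i] by (auto simp: J_def power2_eq_iff)
        ultimately show ?thesis using cinner_eq_0_commute by blast
      qed
      \<comment> \<open>\<open>T\<close> sees only the expansion of \<open>x\<close> along
        \<open>J\<close>, on which \<open>T\<^sup>* T\<close> acts as \<open>t\<^sup>2\<close>.
        Cancelling this factor puts \<open>x\<close> into the span.\<close>
      from expand[OF J this] have "complex_of_real (t\<^sup>2) *\<^sub>C x =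
          complex_of_real (t\<^sup>2) *\<^sub>C (\<Sum>j\<in>J. cinner x (e j) *\<^sub>C e j)"
        unfolding x[symmetric] by (simp add: ATs)
      hence "x = (\<Sum>j\<in>J. cinner x (e j) *\<^sub>C e j)" using t by simp
      also have "\<dots> \<in> complex_vector.span (e ` J)"
        by (intro complex_vector.span_sum complex_vector.span_scale complex_vector.span_base) auto
      finally show "x \<in> complex_vector.span (e ` J)" .
    next
      fix x assume "x \<in> complex_vector.span (e ` J)"
      then obtain K c where K: "finite K" "K \<subseteq> J" "x = (\<Sum>j\<in>K. c j *\<^sub>C e j)"
        unfolding in_span_image_iff[OF orthonormal_inj_on[OF onJ]] by (elim exE conjE)
      have "x = (\<Sum>j\<in>J. (if j \<in> K then c j else 0) *\<^sub>C e j)"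
        unfolding K(3) using K(2) J(1) by (intro sum.mono_neutral_cong_left) auto
      thus "x \<in> {x. hilbert_adjoint T (T x) = complex_of_real (t\<^sup>2) *\<^sub>C x}" using ATs by simp
    qed
    thus ?thesis
      using card_image[OF orthonormal_inj_on[OF onJ]]
        complex_vector.dim_span_eq_card_independent[OF orthonormal_independent[OF onJ J(1)]]
      by (simp add: J_def)
  qed

  have "compact (closure (T ` cball 0 1))"
  proof (rule compact_closure_image_if_approx)
    fix \<epsilon> :: real assume \<epsilon>: "\<epsilon> > 0"
    \<comment> \<open>Only finitely many \<open>\<sigma> i\<close> reach \<open>\<epsilon>\<close>.
      On the closed span of the other \<open>e i\<close> the norm of \<open>T\<close> is at most
      \<open>\<epsilon>\<close>, and on its orthogonal complement \<open>T\<close> has finite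
      rank.\<close>
    define J where "J = {i\<in>I. \<epsilon> \<le> \<sigma> i}"
    have J: "finite J" "J \<subseteq> I" using fin[OF \<epsilon>] by (auto simp: J_def)
    define L where "L = complex_vector.span (e ` (I - J))"
    interpret M: closed_complex_subspace "closure L"
      by unfold_locales (auto simp: L_def intro: complex_subspace_closure)
    have "norm (T x) \<le> \<epsilon> * norm x" if "x \<in> L" for x
    proof (rule power2_le_imp_le)
      have on': "orthonormal (I - J) e" by (rule orthonormal_subset[OF on]) auto
      from that obtain K c where K: "finite K" "K \<subseteq> I - J" "x = (\<Sum>j\<in>K. c j *\<^sub>C e j)"
        unfolding L_def in_span_image_iff[OF orthonormal_inj_on[OF on']] by (elim exE conjE)
      have KI: "K \<subseteq> I" using K by auto
      note onK = orthonormal_subset[OF on KI]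
      have "complex_of_real ((norm (T x))\<^sup>2) =
          (\<Sum>j\<in>K. complex_of_real ((\<sigma> j)\<^sup>2) * cnj (c j) * cinner x (e j))"
        unfolding cinner_self[symmetric] using eig_sum[OF KI, of x c] K(3) by simp
      also have "\<dots> = (\<Sum>j\<in>K. complex_of_real ((\<sigma> j)\<^sup>2 * (cmod (c j))\<^sup>2))"
        unfolding K(3) of_real_mult complex_norm_square
        using cinner_orthonormal_sum[OF onK K(1) order.refl]
        by (intro sum.cong refl) (simp add: mult_ac)
      also have "\<dots> = complex_of_real (\<Sum>j\<in>K. (\<sigma> j)\<^sup>2 * (cmod (c j))\<^sup>2)" by simp
      finally have "(norm (T x))\<^sup>2 = (\<Sum>j\<in>K. (\<sigma> j)\<^sup>2 * (cmod (c j))\<^sup>2)"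
        unfolding of_real_eq_iff .
      also have "\<dots> \<le> (\<Sum>j\<in>K. \<epsilon>\<^sup>2 * (cmod (c j))\<^sup>2)"
        using K(2) by (intro sum_mono mult_right_mono power_mono)
          (auto simp: J_def dest!: subsetD intro: less_imp_le[OF \<sigma>_pos])
      also have "\<dots> = (\<epsilon> * norm x)\<^sup>2"
        unfolding K(3) power_mult_distrib norm_orthonormal_sum[OF onK K(1)] sum_distrib_left ..
      finally show "(norm (T x))\<^sup>2 \<le> (\<epsilon> * norm x)\<^sup>2" .
    qed (use \<epsilon> in simp)
    hence "closure L \<subseteq> {x. norm (T x) \<le> \<epsilon> * norm x}"
      by (intro closure_minimal closed_Collect_le continuous_intros T.continuous_on) auto
    hence small: "norm (T x) \<le> \<epsilon> * norm x" if "x \<in> closure L" for x using that by blast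
    \<comment> \<open>The constant 2 bounds \<open>norm v\<close> below, where \<open>v\<close> is
      the difference of two vectors of norm at most 1.\<close>
    obtain K where K: "compact K" "\<And>c. (\<forall>j\<in>J. cmod (c j) \<le> 2) \<Longrightarrow> (\<Sum>j\<in>J. c j *\<^sub>C T (e j)) \<in> K"
      using compact_coefficient_sums[OF J(1), of 2 "\<lambda>j. T (e j)"] by blast
    have "\<exists>y\<in>K. dist (T x) y \<le> \<epsilon>" if x: "x \<in> cball 0 1" for x
    proof -
      define u where "u = orth_proj (closure L) x"
      define v where "v = x - u"
      have nu: "norm u \<le> 1" using M.norm_orth_proj_le[of x] x by (simp add: u_def)
      have nv: "norm v \<le> 2" using norm_triangle_ineq4[of x u] nu x by (simp add: v_def)
      have "cinner v (e i) = 0" if "i \<in> I - J" for i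
        unfolding v_def u_def
        by (rule M.orth_proj_props, rule subsetD[OF closure_subset])
          (use that in \<open>auto simp: L_def intro: complex_vector.span_base\<close>)
      hence "T v = (\<Sum>j\<in>J. cinner v (e j) *\<^sub>C T (e j))"
        using expand[OF J] by (simp add: T.sum T_scale)
      also have "\<dots> \<in> K"
      proof (rule K(2), rule ballI)
        fix j assume "j \<in> J"
        hence "cinner (e j) (e j) = 1" using on J by (auto simp: orthonormal_def)
        hence "(norm (e j))\<^sup>2 = 1" unfolding cinner_self by (metis of_real_1 of_real_eq_iff)
        hence "norm (e j) = 1" using norm_ge_zero[of "e j"] by (auto simp: power2_eq_1_iff)
        thus "cmod (cinner v (e j)) \<le> 2" using cinner_Cauchy_Schwarz[of v "e j"] nv by simp
      qed
      finally have "T v \<in> K" .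
      moreover have "dist (T x) (T v) \<le> \<epsilon>"
      proof -
        have "dist (T x) (T v) = norm (T u)" by (simp add: dist_norm v_def T.diff)
        also have "\<dots> \<le> \<epsilon> * norm u" by (rule small) (simp add: u_def M.orth_proj_props)
        also have "\<dots> \<le> \<epsilon>" using nu \<epsilon> by simp
        finally show ?thesis .
      qed
      ultimately show ?thesis by blast
    qed
    thus "\<exists>K. compact K \<and> (\<forall>x\<in>cball 0 1. \<exists>y\<in>K. dist (T x) y \<le> \<epsilon>)" using K(1) by blast
  qed
  hence "compact_operator T"
    unfolding compact_operator_def Vector_Spaces.linear_iff
    by (simp add: complex_vector.vector_space_axioms T.add T_scale)
  moreover obtain s where s: "decseq s" "\<And>n. 0 \<le> s n" "\<And>t. t > 0 \<Longrightarrow> finite {n. s n = t}"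
    "\<And>t. t > 0 \<Longrightarrow> card {n. s n = t} = card {i\<in>I. \<sigma> i = t}"
    by (rule decreasing_rearrangement[OF fin]) (assumption, rule that)
  moreover have "singular_value_list T s" unfolding singular_value_list_def using s dim by simp
  moreover have "summable (\<lambda>n. s n powr p)"
    by (rule summable_powr_rearrangement[OF s(2,3) fin_eq s(4) sum])
  ultimately show ?thesis unfolding schatten_class_def by blast
qed

section \<open>Monotone families of subspaces indexed by multi-indices\<close>

text \<open>A decreasing sequence of natural numbers is constant from the position of its minimum
  on, so a tail of it is increasing as well.\<close>

lemma incseq_subsequence_nat:
  fixes s :: "nat \<Rightarrow> nat"
  obtains h :: "nat \<Rightarrow> nat" where "strict_mono h" "incseq (\<lambda>i. s (h i))"
proof -
  obtain g where g: "strict_mono g" "monoseq (\<lambda>i. s (g i))" using seq_monosub[of s] by blast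
  show ?thesis
  proof (cases "incseq (\<lambda>i. s (g i))")
    case True
    thus ?thesis using that g(1) by blast
  next
    case False
    hence dec: "decseq (\<lambda>i. s (g i))" using g(2) by (simp add: monoseq_iff)
    define N where "N = arg_min (\<lambda>i. s (g i)) (\<lambda>_. True)"
    have N: "s (g N) \<le> s (g i)" for i unfolding N_def by (rule arg_min_nat_le) simp
    have "s (g (N + i)) = s (g N)" for i
      using N[of "N + i"] decseqD[OF dec, of N "N + i"] by simp
    hence "incseq (\<lambda>i. s (g (N + i)))" by (simp add: incseq_def)
    moreover have "strict_mono (\<lambda>i. g (N + i))" using g(1) by (simp add: strict_mono_def)
    ultimately show ?thesis by (rule that[rotated])
  qed
qed

text \<open>Dickson's lemma in sequence form. Coordinates are treated one at a time, and passing to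
  a further subsequence keeps the earlier ones increasing.\<close>

lemma dickson_subsequence:
  fixes f :: "nat \<Rightarrow> 'd::finite \<Rightarrow> nat"
  shows "\<exists>h :: nat \<Rightarrow> nat. strict_mono h \<and> (\<forall>i j. i \<le> j \<longrightarrow> f (h i) \<le> f (h j))"
proof -
  have "\<exists>h :: nat \<Rightarrow> nat. strict_mono h \<and> (\<forall>d\<in>D. incseq (\<lambda>i. f (h i) d))" if "finite D" for D
    using that
  proof (induction D)
    case empty
    show ?case by (intro exI[of _ id]) (simp add: strict_mono_def)
  next
    case (insert d D)
    then obtain h where h: "strict_mono h" "\<And>c. c \<in> D \<Longrightarrow> incseq (\<lambda>i. f (h i) c)" by blast
    obtain g where g: "strict_mono g" "incseq (\<lambda>i. f (h (g i)) d)"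
      by (rule incseq_subsequence_nat[of "\<lambda>i. f (h i) d"])
    have "incseq (\<lambda>i. f (h (g i)) c)" if "c \<in> D" for c
      using h(2)[OF that] strict_mono_mono[OF g(1)] by (simp add: incseq_def mono_def)
    thus ?case
      using g h(1) by (intro exI[of _ "h \<circ> g"]) (auto simp: strict_mono_def)
  qed
  from this[OF finite[of UNIV]] obtain h :: "nat \<Rightarrow> nat"
    where "strict_mono h" "\<forall>d\<in>UNIV. incseq (\<lambda>i. f (h i) d)" by blast
  thus ?thesis by (intro exI[of _ h]) (simp add: incseq_def le_fun_def)
qed

text \<open>If jumps in direction \<open>k\<close> occurred at arbitrarily large \<open>n k\<close>,
  an increasing subsequence of jump positions would force the dimensions to grow without
  bound.\<close>

lemma subspace_chain_jumps_bounded: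
  fixes V :: "('d::finite \<Rightarrow> nat) \<Rightarrow> 'a::euclidean_space set"
  assumes sub: "\<And>n. subspace (V n)" and mono: "\<And>m n. m \<le> n \<Longrightarrow> V m \<subseteq> V n"
  shows "\<exists>N. \<forall>n. V (n(k := Suc (n k))) \<noteq> V n \<longrightarrow> n k < N"
proof (rule ccontr)
  assume "\<not> ?thesis"
  hence "\<forall>N. \<exists>n. V (n(k := Suc (n k))) \<noteq> V n \<and> N \<le> n k" by (meson not_le)
  then obtain f where f: "\<And>N. V ((f N)(k := Suc (f N k))) \<noteq> V (f N)" "\<And>N. N \<le> f N k" by metis
  obtain h :: "nat \<Rightarrow> nat" where h: "strict_mono h" "\<And>i j. i \<le> j \<Longrightarrow> f (h i) \<le> f (h j)"
    using dickson_subsequence[of f] by blast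
  have "\<exists>i. c \<le> dim (V (f (h i)))" for c
  proof (induction c)
    case (Suc c)
    then obtain i where i: "c \<le> dim (V (f (h i)))" by blast
    define n where "n = f (h i)"
    \<comment> \<open>This \<open>j\<close> is late enough for \<open>f (h j)\<close> to exceed
      \<open>n\<close> in coordinate \<open>k\<close>, so the enlarged space after the jump at
      \<open>n\<close> is contained in \<open>V (f (h j))\<close>.\<close>
    define j where "j = max i (Suc (n k))"
    have "Suc (n k) \<le> f (h j) k"
      using f(2)[of "h j"] strict_mono_imp_increasing[OF h(1), of j] by (simp add: j_def)
    hence "n(k := Suc (n k)) \<le> f (h j)"
      using h(2)[of i j] by (auto simp: le_fun_def n_def j_def)
    hence *: "V (n(k := Suc (n k))) \<subseteq> V (f (h j))" by (rule mono)
    have le: "V n \<subseteq> V (n(k := Suc (n k)))" by (rule mono) (simp add: le_fun_def)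
    have "dim (V n) < dim (V (n(k := Suc (n k))))"
      using subspace_dim_equal[OF sub sub le] f(1)[of "h i"] unfolding n_def by (metis not_le)
    also have "\<dots> \<le> dim (V (f (h j)))" using * by (rule dim_subset)
    finally show ?case using i by (intro exI[of _ j]) (simp add: n_def)
  qed auto
  from this[of "Suc DIM('a)"] show False using dim_subset_UNIV not_less_eq_eq by blast
qed

text \<open>As \<open>n i \<le> mi_deg n\<close>, each term is at most a product of one-variable
  terms with exponent \<open>q / CARD('d) > 1\<close>, and over a box the sum of these products
  factors.\<close>

lemma mi_deg_powr_summable:
  assumes q: "q > real CARD('d)"
  shows "(\<lambda>n :: 'd::finite \<Rightarrow> nat. (real (Suc (mi_deg n))) powr (- q)) summable_on UNIV"
proof (rule nonneg_bdd_above_summable_on)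
  define r where "r = q / CARD('d)"
  define a where "a j = real (Suc j) powr (- r)" for j
  have "- r < -1" using q by (simp add: r_def)
  hence "summable (\<lambda>j. real j powr (- r))" unfolding summable_real_powr_iff .
  hence a: "summable a" unfolding a_def by (subst summable_Suc_iff)
  have le: "real (Suc (mi_deg n)) powr (- q) \<le> (\<Prod>i\<in>UNIV. a (n i))" for n :: "'d \<Rightarrow> nat"
  proof -
    have "real (Suc (mi_deg n)) powr (- q) = (real (Suc (mi_deg n)) powr (- r)) ^ CARD('d)"
      by (simp add: powr_power r_def)
    also have "\<dots> = (\<Prod>i\<in>(UNIV::'d set). real (Suc (mi_deg n)) powr (- r))" by simp
    also have "\<dots> \<le> (\<Prod>i\<in>UNIV. a (n i))"
    proof (rule prod_mono)
      fix i
      have "n i \<le> mi_deg n" unfolding mi_deg_def by (intro member_le_sum) auto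
      thus "0 \<le> real (Suc (mi_deg n)) powr (- r) \<and> real (Suc (mi_deg n)) powr (- r) \<le> a (n i)"
        unfolding a_def using \<open>- r < -1\<close> by (auto intro!: powr_mono2')
    qed
    finally show ?thesis .
  qed
  show "bdd_above (sum (\<lambda>n :: 'd \<Rightarrow> nat. real (Suc (mi_deg n)) powr (- q)) ` {F. F \<subseteq> UNIV \<and> finite F})"
  proof (rule bdd_aboveI2)
    fix F :: "('d \<Rightarrow> nat) set" assume "F \<in> {F. F \<subseteq> UNIV \<and> finite F}"
    hence F: "finite F" by simp
    define K where "K = Max (insert 0 (mi_deg ` F))"
    have "n i \<le> K" if "n \<in> F" for n i
    proof -
      have "n i \<le> mi_deg n" unfolding mi_deg_def by (intro member_le_sum) auto
      also have "mi_deg n \<le> K" unfolding K_def using F that by (intro Max_ge) auto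
      finally show ?thesis .
    qed
    hence sub: "F \<subseteq> PiE UNIV (\<lambda>_. {..K})" by auto
    have "(\<Sum>n\<in>F. real (Suc (mi_deg n)) powr (- q)) \<le> (\<Sum>n\<in>F. \<Prod>i\<in>UNIV. a (n i))"
      by (intro sum_mono le)
    also have "\<dots> \<le> (\<Sum>n\<in>PiE (UNIV::'d set) (\<lambda>_. {..K}). \<Prod>i\<in>UNIV. a (n i))"
      by (intro sum_mono2 sub finite_PiE prod_nonneg) (auto simp: a_def)
    also have "\<dots> = (\<Prod>i\<in>(UNIV::'d set). \<Sum>j\<le>K. a j)" by (subst prod_sum_PiE) auto
    also have "\<dots> \<le> (\<Prod>i\<in>(UNIV::'d set). suminf a)"
      by (intro prod_mono conjI sum_nonneg sum_le_suminf a) (auto simp: a_def)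
    finally show "(\<Sum>n\<in>F. real (Suc (mi_deg n)) powr (- q)) \<le> (\<Prod>i\<in>(UNIV::'d set). suminf a)" .
  qed
qed auto

text \<open>Complex orthonormality implies orthogonality for \<open>inner\<close>, so the real
  dimension is a bound. For \<open>complex ^ 'r\<close> it is twice the complex dimension, a factor
  absorbed by the constant in the final estimate.\<close>

lemma orthonormal_card_le:
  fixes B :: "'a::{complex_hilbert, euclidean_space} set"
  assumes "orthonormal B id"
  shows "finite B \<and> card B \<le> DIM('a)"
proof (rule independent_bound, rule pairwise_orthogonal_independent)
  show "pairwise orthogonal B"
    using assms by (auto simp: pairwise_def orthogonal_def orthonormal_def inner_eq_Re_cinner)
  show "0 \<notin> B" using assms by (force simp: orthonormal_def)
qed

text \<open>An orthonormal subset of \<open>W\<close> of largest size is total, since a nonzero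
  vector of \<open>W\<close> orthogonal to it could be normalized and added.\<close>

lemma orthonormal_basis_exists:
  fixes W :: "'a::{complex_hilbert, euclidean_space} set"
  assumes W: "complex_vector.subspace W"
  obtains B where "B \<subseteq> W" "orthonormal B id" "\<And>w. w \<in> W \<Longrightarrow> (\<And>b. b \<in> B \<Longrightarrow> cinner w b = 0) \<Longrightarrow> w = 0"
proof -
  define P where "P B \<longleftrightarrow> B \<subseteq> W \<and> orthonormal B id" for B
  have "P {}" by (simp add: P_def orthonormal_def)
  moreover have "\<forall>B. P B \<longrightarrow> card B < Suc DIM('a)"
    using orthonormal_card_le by (auto simp: P_def less_Suc_eq_le)
  ultimately obtain B where B: "P B" and max: "\<And>C. P C \<Longrightarrow> card C \<le> card B"
    using ex_has_greatest_nat[of P "{}" card "Suc DIM('a)"] by (auto simp: less_imp_le)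
  have "w = 0" if w: "w \<in> W" "\<And>b. b \<in> B \<Longrightarrow> cinner w b = 0" for w
  proof (rule ccontr)
    assume "w \<noteq> 0"
    define v where "v = complex_of_real (1 / norm w) *\<^sub>C w"
    have v: "cinner v b = 0" "cinner b v = 0" if "b \<in> B" for b
      using w(2)[OF that] cinner_eq_0_commute[of w b]
      by (simp_all add: v_def cinner_scaleC_left cinner_scaleC_right)
    have vv: "cinner v v = 1"
      using \<open>w \<noteq> 0\<close> by (simp add: v_def cinner_self norm_scaleC norm_divide)
    have "v \<notin> B" using v vv by force
    have "P (insert v B)"
      unfolding P_def
    proof
      show "insert v B \<subseteq> W"
        using B complex_vector.subspace_scale[OF W w(1)] by (auto simp: P_def v_def)
      show "orthonormal (insert v B) id"
        using B v vv \<open>v \<notin> B\<close> by (auto simp: P_def orthonormal_def)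
    qed
    from max[OF this] show False
      using \<open>v \<notin> B\<close> B orthonormal_card_le[of B] by (simp add: P_def)
  qed
  thus ?thesis using B by (intro that[of B]) (auto simp: P_def)
qed

section \<open>Coefficients of elements of \<open>H\<^sup>2 \<otimes> \<complex>\<^sup>r\<close>\<close>

definition tensor_coeff :: "('d::finite) fock ^ 'r::finite \<Rightarrow> ('d \<Rightarrow> nat) \<Rightarrow> complex ^ 'r" where
  "tensor_coeff F n = (\<chi> i. fock_coeff (F $ i) n)"

lemma
  shows tensor_coeff_zero [simp]: "tensor_coeff 0 n = 0"
    and tensor_coeff_add: "tensor_coeff (F + G) n = tensor_coeff F n + tensor_coeff G n"
    and tensor_coeff_diff: "tensor_coeff (F - G) n = tensor_coeff F n - tensor_coeff G n"
    and tensor_coeff_scaleC: "tensor_coeff (c *\<^sub>C F) n = c *\<^sub>C tensor_coeff F n"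
    and tensor_coeff_scaleR: "tensor_coeff (r *\<^sub>R F) n = r *\<^sub>R tensor_coeff F n"
  by (simp_all add: tensor_coeff_def vec_eq_iff scaleC_vec_def scaleC_complex_def scaleR_complex.code
      complex_eq_iff)

lemma tensor_coeff_eqI: "(\<And>n. tensor_coeff F n = tensor_coeff G n) \<Longrightarrow> F = G"
  by (simp add: tensor_coeff_def vec_eq_iff fock_coeff_inject[symmetric] fun_eq_iff)

lemma tensor_coeff_monomial:
  "tensor_coeff (fock_tensor (fock_monomial m) \<zeta>) n = (if n = m then \<zeta> else 0)"
  by (simp add: tensor_coeff_def fock_tensor_def vec_eq_iff fock_coeff_monomial)

lemma tensor_coeff_d_shift:
  "tensor_coeff (d_shift k F) n = (if n k = 0 then 0 else tensor_coeff F (n(k := n k - 1)))"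
  by (simp add: tensor_coeff_def d_shift_def vec_eq_iff fock_coeff_coord_mult mi_shift_def)

lemma tensor_coeff_d_shift_Suc: "tensor_coeff (d_shift k F) (n(k := Suc (n k))) = tensor_coeff F n"
  by (simp add: tensor_coeff_d_shift)

lemma d_shift_monomial:
  "d_shift k (fock_tensor (fock_monomial n) \<zeta>) = fock_tensor (fock_monomial (n(k := Suc (n k)))) \<zeta>"
  by (rule tensor_coeff_eqI) (auto simp: tensor_coeff_d_shift tensor_coeff_monomial)

lemma d_shift_scaleC: "d_shift k (c *\<^sub>C F) = c *\<^sub>C d_shift k F"
  by (simp add: d_shift_def scaleC_vec_def vec_eq_iff coord_mult_scaleC)

lemma fock_tensor_zero: "fock_tensor f 0 = 0"
  by (simp add: fock_tensor_def vec_eq_iff)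

text \<open>Pairing with monomials reads off coefficients, which turns orthogonality in the tensor
  product into orthogonality in the coefficient space.\<close>

lemma cinner_monomial_left:
  "cinner (fock_tensor (fock_monomial n) \<zeta>) F =
    complex_of_real (fock_weight n) * cinner \<zeta> (tensor_coeff F n)"
  by (simp add: cinner_vec_def fock_tensor_def cinner_scaleC_left cinner_fock_monomial_left
      tensor_coeff_def cinner_complex_def sum_distrib_left mult_ac)

lemma cinner_monomial_right:
  "cinner F (fock_tensor (fock_monomial n) \<zeta>) =
    complex_of_real (fock_weight n) * cinner (tensor_coeff F n) \<zeta>"
  by (subst (1 2) cinner_commute) (simp add: cinner_monomial_left)

lemma bounded_linear_tensor_coeff: "bounded_linear (\<lambda>F. tensor_coeff F n)"
proof (rule bounded_linear_intro[where K = "1 / sqrt (fock_weight n)"])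
  fix F :: "'a fock ^ 'b"
  have "norm (tensor_coeff F n) \<le> L2_set (\<lambda>i. norm (F $ i) / sqrt (fock_weight n)) UNIV"
    unfolding norm_vec_def by (rule L2_set_mono) (simp_all add: tensor_coeff_def fock_coeff_bound)
  also have "\<dots> = L2_set (\<lambda>i. norm (F $ i) * (1 / sqrt (fock_weight n))) UNIV" by simp
  also have "\<dots> = norm F * (1 / sqrt (fock_weight n))"
    unfolding norm_vec_def by (rule L2_set_left_distrib[symmetric]) simp
  finally show "norm (tensor_coeff F n) \<le> norm F * (1 / sqrt (fock_weight n))" .
qed (simp_all add: tensor_coeff_add tensor_coeff_scaleR)

lemma continuous_on_fock_tensor: "continuous_on A (fock_tensor f)"
  unfolding fock_tensor_def
  by (intro continuous_on_vec_lambda linear_continuous_on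
      bounded_linear_compose[OF bounded_linear_scaleC bounded_linear_vec_nth])

lemma fock_tensor_add: "fock_tensor f (\<zeta> + \<eta>) = fock_tensor f \<zeta> + fock_tensor f \<eta>"
  by (simp add: fock_tensor_def vec_eq_iff scaleC_add_left)

lemma fock_tensor_scaleC: "fock_tensor f (c *\<^sub>C \<zeta>) = c *\<^sub>C fock_tensor f \<zeta>"
  by (simp add: fock_tensor_def vec_eq_iff scaleC_vec_def scaleC_complex_def scaleC_scaleC)

section \<open>The slices \<open>V\<^sub>n\<close> of an invariant subspace\<close>

definition slice :: "(('d::finite) fock ^ 'r::finite) set \<Rightarrow> ('d \<Rightarrow> nat) \<Rightarrow> (complex ^ 'r) set" where
  "slice M n = {\<zeta>. fock_tensor (fock_monomial n) \<zeta> \<in> M}"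

text \<open>Downward induction from \<open>n\<close> in unit steps, along the gap between the total
  degrees. A unit step is what a single shift does to a monomial.\<close>

lemma mi_le_induct [consumes 1, case_names refl step]:
  fixes m n :: "'d::finite \<Rightarrow> nat"
  assumes "m \<le> n" "P n" and step: "\<And>i m. m i < n i \<Longrightarrow> m \<le> n \<Longrightarrow> P (m(i := Suc (m i))) \<Longrightarrow> P m"
  shows "P m"
  using assms(1)
proof (induction "mi_deg n - mi_deg m" arbitrary: m rule: less_induct)
  case less
  show ?case
  proof (cases "m = n")
    case False
    then obtain i where i: "m i < n i"
      using less.prems by (meson le_funD le_neq_implies_less ext)
    define m' where "m' = m(i := Suc (m i))"
    have le: "m' \<le> n" using less.prems i by (auto simp: m'_def le_fun_def)
    hence "mi_deg m' \<le> mi_deg n" unfolding mi_deg_def by (intro sum_mono) (auto simp: le_fun_def)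
    hence "mi_deg n - mi_deg m' < mi_deg n - mi_deg m"
      unfolding m'_def mi_deg_upd by simp
    thus ?thesis using step[OF i less.prems] less.hyps[OF _ le] by (simp add: m'_def)
  qed (use assms(2) in simp)
qed

lemma closed_invariant_subspace_slice:
  assumes "closed_invariant_subspace M"
  shows "closed_complex_subspace (slice M n)"
proof
  have M: "complex_vector.subspace M" and cl: "closed M"
    using assms by (auto simp: closed_invariant_subspace_def)
  have "fock_tensor (fock_monomial n) 0 \<in> M"
    using complex_vector.subspace_0[OF M] by (simp add: fock_tensor_zero)
  thus "complex_vector.subspace (slice M n)"
    by (auto intro!: complex_vector.subspaceI complex_vector.subspace_add[OF M]
        complex_vector.subspace_scale[OF M] simp: slice_def fock_tensor_add fock_tensor_scaleC)
  have "closed (fock_tensor (fock_monomial n) -` M)"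
    by (intro continuous_closed_vimage cl) (metis continuous_on_fock_tensor continuous_on_eq_continuous_at open_UNIV UNIV_I)
  thus "closed (slice M n)" by (simp add: slice_def vimage_def)
qed

text \<open>The \<open>i\<close>-th shift raises the \<open>i\<close>-th exponent of a monomial and
  keeps its vector, so membership in \<open>M\<close> passes on.\<close>

lemma slice_mono:
  assumes "closed_invariant_subspace M" "m \<le> n"
  shows "slice M m \<subseteq> slice M n"
  using assms(2)
proof (induction rule: mi_le_induct)
  case (step i m)
  have "fock_tensor (fock_monomial (m(i := Suc (m i)))) \<zeta> \<in> M"
    if "fock_tensor (fock_monomial m) \<zeta> \<in> M" for \<zeta>
    unfolding d_shift_monomial[symmetric]
    using assms(1) that by (auto simp: closed_invariant_subspace_def)
  hence "slice M m \<subseteq> slice M (m(i := Suc (m i)))" by (auto simp: slice_def)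
  thus ?case using step by blast
qed simp

text \<open>The elements all of whose coefficients lie in the slices of \<open>M\<close> form a closed invariant
  subspace that contains the generators.\<close>
lemma tensor_coeff_in_slice:
  assumes M: "closed_invariant_subspace M" "G \<subseteq> monomials" "M = closed_invariant_subspace hull G"
    and F: "F \<in> M"
  shows "tensor_coeff F n \<in> slice M n"
proof -
  define N where "N = {F. \<forall>n. tensor_coeff F n \<in> slice M n}"
  interpret V: closed_complex_subspace "slice M n" for n
    by (rule closed_invariant_subspace_slice[OF M(1)])
  have "closed_invariant_subspace N"
    unfolding closed_invariant_subspace_def
  proof (intro conjI allI)
    show "complex_vector.subspace N"
      unfolding N_def
      by (rule complex_vector.subspaceI)
        (auto simp: tensor_coeff_add tensor_coeff_scaleC intro: complex_vector.subspace_0[OF V.sub]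
          complex_vector.subspace_add[OF V.sub] complex_vector.subspace_scale[OF V.sub])
    have "N = (\<Inter>n. (\<lambda>F. tensor_coeff F n) -` slice M n)" by (auto simp: N_def)
    also have "closed \<dots>"
      by (intro closed_INT ballI continuous_closed_vimage V.clo
          linear_continuous_at[OF bounded_linear_tensor_coeff])
    finally show "closed N" .
    fix k
    show "d_shift k ` N \<subseteq> N"
    proof (clarsimp simp: N_def tensor_coeff_d_shift complex_vector.subspace_0[OF V.sub])
      fix F n assume "\<forall>n. tensor_coeff F n \<in> slice M n"
      moreover have "slice M (n(k := n k - Suc 0)) \<subseteq> slice M n"
        by (rule slice_mono[OF M(1)]) (simp add: le_fun_def)
      ultimately show "tensor_coeff F (n(k := n k - Suc 0)) \<in> slice M n" by blast
    qed
  qed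
  moreover have "G \<subseteq> N"
  proof
    fix F assume "F \<in> G"
    moreover from this obtain m \<zeta> where "F = fock_tensor (fock_monomial m) \<zeta>"
      using M(2) by (auto simp: monomials_def)
    moreover have "G \<subseteq> M" unfolding M(3) by (rule hull_subset)
    ultimately show "F \<in> N"
      by (auto simp: N_def tensor_coeff_monomial slice_def
          complex_vector.subspace_0[OF V.sub, unfolded slice_def mem_Collect_eq])
  qed
  ultimately have "M \<subseteq> N" unfolding M(3) by (intro hull_minimal)
  thus ?thesis using F by (auto simp: N_def)
qed

text \<open>The coefficient of the projection lies in the slice because \<open>M\<close> is
  generated by monomials. The difference is orthogonal to the slice because
  \<open>z\<^sup>n \<otimes> u\<close> belongs to \<open>M\<close> for every \<open>u\<close> in
  it.\<close>

lemma tensor_coeff_orth_proj: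
  assumes M: "closed_invariant_subspace M" "G \<subseteq> monomials" "M = closed_invariant_subspace hull G"
  shows "tensor_coeff (orth_proj M F) n = orth_proj (slice M n) (tensor_coeff F n)"
proof (rule orth_proj_eqI[symmetric])
  interpret closed_complex_subspace M
    using M(1) by unfold_locales (auto simp: closed_invariant_subspace_def)
  interpret V: closed_complex_subspace "slice M n"
    by (rule closed_invariant_subspace_slice[OF M(1)])
  show "complex_vector.subspace (slice M n)" by (rule V.sub)
  show "tensor_coeff (orth_proj M F) n \<in> slice M n"
    by (intro tensor_coeff_in_slice[OF M] orth_proj_props)
  fix u assume "u \<in> slice M n"
  hence "cinner (F - orth_proj M F) (fock_tensor (fock_monomial n) u) = 0"
    by (intro orth_proj_props) (simp add: slice_def)
  thus "cinner (tensor_coeff F n - tensor_coeff (orth_proj M F) n) u = 0"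
    by (simp add: cinner_monomial_right tensor_coeff_diff)
qed

section \<open>The commutator and its singular values\<close>

theorem theorem2p1:
  fixes M G :: "(('d::finite) fock ^ 'r::finite) set"
    and p :: real and k :: 'd
  assumes "closed_invariant_subspace M"
    and "G \<subseteq> monomials"
    and "M = closed_invariant_subspace hull G"
    and "p > 2 * real CARD('d)"
  shows "(\<lambda>F. orth_proj M (d_shift k F) - d_shift k (orth_proj M F)) \<in> schatten_class p"
proof -
  note M = assms(1-3)
  interpret M: closed_complex_subspace M
    using M(1) by unfold_locales (auto simp: closed_invariant_subspace_def)
  define V where "V = slice M"
  interpret V: closed_complex_subspace "V n" for n
    unfolding V_def by (rule closed_invariant_subspace_slice[OF M(1)])
  define up where "up n = n(k := Suc (n k))" for n :: "'d \<Rightarrow> nat"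
  \<comment> \<open>Every coefficient of \<open>T F\<close> thus belongs to one of two cases, which
    are computed in \<open>coeff_T_0\<close> and \<open>coeff_T_up\<close>.\<close>
  have up_cases: "m k = 0 \<or> (\<exists>n. m = up n)" for m
    using mi_shift_range[of m k] by (auto simp: up_def)
  have up_k: "up n k = Suc (n k)" for n by (simp add: up_def)
  have up_inj: "up m = up n \<longleftrightarrow> m = n" for m n
    using injD[OF mi_shift_inj[of k], of m n] by (auto simp: up_def)
  have V_mono: "V m \<subseteq> V n" if "m \<le> n" for m n
    unfolding V_def by (rule slice_mono[OF M(1) that])
  have V_up: "V n \<subseteq> V (up n)" for n by (rule V_mono) (simp add: up_def le_fun_def)
  define T where "T F = orth_proj M (d_shift k F) - d_shift k (orth_proj M F)" for F
  \<comment> \<open>As \<open>V n\<close> is contained in \<open>V (up n)\<close>, this is the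
    orthogonal projection onto the complement of \<open>V n\<close> in \<open>V (up n)\<close>,
    called \<open>W n\<close> below.\<close>
  define E where "E n c = orth_proj (V (up n)) c - orth_proj (V n) c" for n c

  have T_bounded: "bounded_linear T"
    unfolding T_def
    by (intro bounded_linear_sub bounded_linear_compose[OF M.bounded_linear_orth_proj]
        bounded_linear_compose[OF bounded_linear_d_shift] bounded_linear_d_shift
        M.bounded_linear_orth_proj)
  have T_scale: "T (c *\<^sub>C F) = c *\<^sub>C T F" for c F
    by (simp add: T_def d_shift_scaleC M.orth_proj_scaleC complex_vector.scale_right_diff_distrib)
  \<comment> \<open>A shifted element has coefficient 0 at such \<open>m\<close>, and the projection
    onto \<open>V m\<close> keeps it 0.\<close>
  have coeff_T_0: "tensor_coeff (T F) m = 0" if "m k = 0" for F m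
    using that V.orth_proj_id[OF complex_vector.subspace_0[OF V.sub]]
    by (simp add: T_def tensor_coeff_diff tensor_coeff_orth_proj[OF M] tensor_coeff_d_shift flip: V_def)
  have coeff_T_up: "tensor_coeff (T F) (up n) = E n (tensor_coeff F n)" for F n
    by (simp add: T_def E_def up_def tensor_coeff_diff tensor_coeff_orth_proj[OF M]
        tensor_coeff_d_shift_Suc V_def del: fun_upd_apply)

  define W where "W n = {\<zeta>\<in>V (up n). \<forall>u\<in>V n. cinner \<zeta> u = 0}" for n
  have W_sub: "complex_vector.subspace (W n)" for n
    by (rule complex_vector.subspaceI)
      (auto simp: W_def cinner_add_left cinner_scaleC_left complex_vector.subspace_0[OF V.sub]
        complex_vector.subspace_add[OF V.sub] complex_vector.subspace_scale[OF V.sub])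
  have E_W: "E n c \<in> W n" for n c
  proof -
    have "E n c \<in> V (up n)"
      unfolding E_def using V_up V.orth_proj_props by (intro complex_vector.subspace_diff[OF V.sub]) auto
    moreover have "cinner (E n c) u = 0" if "u \<in> V n" for u
      using that subsetD[OF V_up that] by (simp add: E_def cinner_diff_left V.cinner_orth_proj_left)
    ultimately show ?thesis by (simp add: W_def)
  qed
  have E_id: "E n w = w" if "w \<in> W n" for n w
    using that by (simp add: E_def W_def V.orth_proj_id V.orth_proj_eq_0)
  have E_commute: "cinner (E n c) u = cinner c (E n u)" for n c u
    by (simp add: E_def cinner_diff_left cinner_diff_right V.cinner_orth_proj_commute)

  have "\<exists>B. B \<subseteq> W n \<and> orthonormal B id \<and> (\<forall>w\<in>W n. (\<forall>b\<in>B. cinner w b = 0) \<longrightarrow> w = 0)" for n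
    using orthonormal_basis_exists[OF W_sub[of n]] by metis
  then obtain B where B: "\<And>n. B n \<subseteq> W n" "\<And>n. orthonormal (B n) id"
    and B_total: "\<And>n w. w \<in> W n \<Longrightarrow> (\<forall>b\<in>B n. cinner w b = 0) \<Longrightarrow> w = 0" by metis
  have B_card: "finite (B n)" "card (B n) \<le> DIM(complex ^ 'r)" for n
    using orthonormal_card_le[OF B(2)] by auto

  \<comment> \<open>The second component \<open>b\<close> accounts for multiplicity. Since
    \<open>z\<^sup>n \<otimes> b\<close> has squared norm \<open>fock_weight n\<close>,
    \<open>e\<close> is scaled to unit vectors, and \<open>\<sigma>\<close> is the factor by which
    \<open>T\<close> changes their norm.\<close>
  define I where "I = Sigma UNIV B"
  define e where "e = (\<lambda>(n, b). fock_tensor (fock_monomial n)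
    (complex_of_real (1 / sqrt (fock_weight n)) *\<^sub>C b) :: 'd fock ^ 'r)"
  define \<sigma> where "\<sigma> = (\<lambda>(n, b :: complex ^ 'r). sqrt (fock_weight (up n) / fock_weight n))"

  have T_monomial: "T (fock_tensor (fock_monomial n) w) = fock_tensor (fock_monomial (up n)) w"
    if "w \<in> W n" for n w
  proof (rule tensor_coeff_eqI)
    fix m
    have E0: "E m 0 = 0" for m
      using V.orth_proj_id[OF complex_vector.subspace_0[OF V.sub]] by (simp add: E_def)
    show "tensor_coeff (T (fock_tensor (fock_monomial n) w)) m =
        tensor_coeff (fock_tensor (fock_monomial (up n)) w) m"
      using up_cases[of m] E_id[OF that]
      by (auto simp: coeff_T_0 coeff_T_up tensor_coeff_monomial up_k up_inj E0)
  qed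

  have "T \<in> schatten_class p"
  proof (rule schatten_classI[OF T_bounded T_scale])
    have sq: "complex_of_real (sqrt (fock_weight n)) * complex_of_real (sqrt (fock_weight n)) = fock_weight n"
      for n :: "'d \<Rightarrow> nat" by (simp flip: of_real_mult)
    show "orthonormal I e"
      unfolding orthonormal_def
    proof (intro ballI)
      fix i j assume ij: "i \<in> I" "j \<in> I"
      obtain n b m c where nm: "i = (n, b)" "j = (m, c)" by (cases i, cases j) auto
      show "cinner (e i) (e j) = (if i = j then 1 else 0)"
        using B(2)[of n] ij sq[of n]
        by (auto simp: nm e_def I_def cinner_monomial_left tensor_coeff_monomial cinner_scaleC_left
            cinner_scaleC_right orthonormal_def field_simps)
    qed
    show "0 < \<sigma> i" if "i \<in> I" for i by (auto simp: \<sigma>_def split: prod.splits)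
    show "cinner (T F) (T (e i)) = complex_of_real ((\<sigma> i)\<^sup>2) * cinner F (e i)" if "i \<in> I" for i F
    proof -
      from that obtain n b where nb: "i = (n, b)" "b \<in> B n" by (auto simp: I_def)
      define w where "w = complex_of_real (1 / sqrt (fock_weight n)) *\<^sub>C b"
      have w: "w \<in> W n" unfolding w_def using nb B(1) by (intro complex_vector.subspace_scale[OF W_sub]) auto
      have ei: "e i = fock_tensor (fock_monomial n) w" by (simp add: e_def nb w_def)
      have "cinner (T F) (T (e i)) = fock_weight (up n) * cinner (E n (tensor_coeff F n)) w"
        by (simp add: ei T_monomial[OF w] cinner_monomial_right coeff_T_up)
      \<comment> \<open>\<open>E n\<close> is self-adjoint and fixes \<open>w\<close>.\<close>
      also have "cinner (E n (tensor_coeff F n)) w = cinner (tensor_coeff F n) w"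
        by (simp add: E_commute E_id[OF w])
      finally show ?thesis
        unfolding ei by (simp add: cinner_monomial_right nb(1) \<sigma>_def)
    qed
    show "T F = 0" if F: "\<And>i. i \<in> I \<Longrightarrow> cinner F (e i) = 0" for F
    proof (rule tensor_coeff_eqI)
      fix m
      \<comment> \<open>This vector lies in \<open>W n\<close>, and by self-adjointness of
        \<open>E n\<close> it is orthogonal to the basis \<open>B n\<close>.\<close>
      have "E n (tensor_coeff F n) = 0" for n
      proof (rule B_total[OF E_W], rule ballI)
        fix b assume b: "b \<in> B n"
        have "cinner (tensor_coeff F n) b = 0"
          using F[of "(n, b)"] b by (simp add: I_def e_def cinner_monomial_right cinner_scaleC_right)
        thus "cinner (E n (tensor_coeff F n)) b = 0"
          using E_commute E_id B(1) b by (metis subsetD)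
      qed
      thus "tensor_coeff (T F) m = tensor_coeff 0 m"
        using up_cases[of m] by (auto simp: coeff_T_0 coeff_T_up)
    qed
    have p0: "p > 0" using assms(4) by (rule le_less_trans[rotated]) simp
    thus "0 < p" .
    have "\<exists>N. \<forall>n. V (n(k := Suc (n k))) \<noteq> V n \<longrightarrow> n k < N"
      by (rule subspace_chain_jumps_bounded[OF subspace_if_complex_subspace[OF V.sub] V_mono])
    then obtain N where N: "\<And>n. V (up n) \<noteq> V n \<Longrightarrow> n k < N" by (auto simp: up_def)
    \<comment> \<open>The dimension bounds the multiplicity \<open>card (B n)\<close>, and
      \<open>N\<close> bounds the numerator \<open>n k + 1\<close> of the squared singular value
      wherever a jump occurs.\<close>
    define C where "C = real DIM(complex ^ 'r) * real N powr (p / 2)"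
    show "(\<lambda>i. \<sigma> i powr p) summable_on I"
      unfolding I_def
    proof (rule summable_on_SigmaI)
      show "((\<lambda>b. \<sigma> (n, b) powr p) has_sum (\<Sum>b\<in>B n. \<sigma> (n, b) powr p)) (B n)" for n
        by (rule has_sum_finite[OF B_card(1)])
      show "(\<lambda>n. \<Sum>b\<in>B n. \<sigma> (n, b) powr p) summable_on UNIV"
      proof (rule summable_on_comparison_test)
        show "(\<lambda>n :: 'd \<Rightarrow> nat. C * real (Suc (mi_deg n)) powr (- (p / 2))) summable_on UNIV"
          \<comment> \<open>The hypothesis on \<open>p\<close> makes the exponent
            \<open>p / 2\<close> exceed the number of variables.\<close>
          using assms(4) by (intro summable_on_cmult_right mi_deg_powr_summable) simp
        show "(\<Sum>b\<in>B n. \<sigma> (n, b) powr p) \<le> C * real (Suc (mi_deg n)) powr (- (p / 2))" for n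
        proof -
          have "\<sigma> (n, b) powr p \<le> real N powr (p / 2) * real (Suc (mi_deg n)) powr (- (p / 2))"
            if b: "b \<in> B n" for b
          proof -
            \<comment> \<open>Basis vectors occur only at jumps: if \<open>V (up n) = V n\<close>,
              then \<open>b\<close> would be orthogonal to itself.\<close>
            have "cinner b b = 1" using B(2)[of n] b by (auto simp: orthonormal_def)
            moreover have "cinner b b = 0" if "V (up n) = V n"
              using subsetD[OF B(1) b] that unfolding W_def by blast
            ultimately have nN: "n k < N" using N[of n] by auto
            have "\<sigma> (n, b) powr p = (real (Suc (n k)) / real (Suc (mi_deg n))) powr (p / 2)"
              by (simp add: \<sigma>_def up_def fock_weight_upd powr_half_sqrt[symmetric] powr_powr del: of_nat_Suc)
            also have "\<dots> \<le> (real N / real (Suc (mi_deg n))) powr (p / 2)"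
              using nN p0 by (intro powr_mono2 divide_right_mono) auto
            also have "\<dots> = real N powr (p / 2) * real (Suc (mi_deg n)) powr (- (p / 2))"
              by (simp add: powr_divide powr_minus_divide del: of_nat_Suc)
            finally show ?thesis .
          qed
          hence "(\<Sum>b\<in>B n. \<sigma> (n, b) powr p) \<le>
              card (B n) * (real N powr (p / 2) * real (Suc (mi_deg n)) powr (- (p / 2)))"
            by (intro sum_bounded_above)
          also have "\<dots> \<le> DIM(complex ^ 'r) * (real N powr (p / 2) * real (Suc (mi_deg n)) powr (- (p / 2)))"
            using B_card(2)[of n] by (intro mult_right_mono) auto
          finally show ?thesis by (simp add: C_def mult.assoc)
        qed
      qed (auto intro: sum_nonneg)
    qed auto
  qed
  thus ?thesis unfolding T_def .
qed

end
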